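(* Let $l\ge2$, let $P=U_l$ be the uniform distribution on $l$ elements, and let $Q$ be a non-uniform probability distribution on a finite set. For all $s_2,t_2\in\mathbb R$, $F^{\mathcal D}_{U_l,Q,s_2}(t_2)=F^{\mathcal M}_{U_l,Q,s_2}(t_2)$, and the common value $F_{U_l,Q,s_2}(t_2)$ is $$F_{U_l,Q,s_2}(t_2)=\sqrt{\Phi\left(\sqrt{\frac{H(Q)}{V(Q)\log l}}\,\big(\min\{s_2,0\}-H(Q)t_2\big)\right)}.$$ In particular, $$F_{U_l,Q,s_2}(t_2)=\lim_{P\to U_l}\sqrt{1-Z_{C_{P,Q},\frac{s_2}{\sqrt{V(P)}}}(t_2D_{P,Q})},$$ where the limit is over non-uniform distributions $P$ on the $l$-element set converging to $U_l$.
   Context: All logarithms are to base $2$. $\mathcal P(\mathcal X)$ is the set of probability distributions on a finite set $\mathcal X$; $P^n$ is the $n$-fold i.i.d. product. $H(P)=-\sum_x P(x)\log P(x)$, $V(P)=\sum_x P(x)(-\log P(x)-H(P))^2$. Non-uniform means not uniform on its support, i.e. $V>0$. $C_{P,Q}=\frac{H(P)}{V(P)}\left(\frac{H(Q)}{V(Q)}\right)^{-1}$ and $D_{P,Q}=\frac{H(Q)}{\sqrt{V(P)}}$. For a map $f:\mathcal X\to\mathcal Y$, $W_f(P)(y)=\sum_{x\in f^{-1}(y)}P(x)$. Fidelity: $F(Q,Q')=\sum_y\sqrt{Q(y)}\sqrt{Q'(y)}$. $P^{\downarrow}_i$ is the $i$-th largest value of $P$ (and $0$ beyond the size of the set). $P\prec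 Q$ means $\sum_{i=1}^l P^{\downarrow}_i\le\sum_{i=1}^l Q^{\downarrow}_i$ for all $l$ (the finite sets may differ). A storage of $N$ bits is $K_N=\{0,1\}^N$; for real $N\ge0$ it is a set of $\lfloor 2^N\rfloor$ elements. A real exponent $Q^t$ means $Q^{\lfloor t\rfloor}$. For $P\in\mathcal P(\mathcal X)$, $Q\in\mathcal P(\mathcal Y)$, $F^{\mathcal D}(P\to Q|N)=\sup_{f:\mathcal X\to K_N,\ f':K_N\to\mathcal Y}F(W_{f'}\circ W_f(P),Q)$ and $F^{\mathcal M}(P\to Q|N)=\sup\{F(P'',Q)\mid P''\in\mathcal P(\mathcal Y),\ \exists P'\in\mathcal P(K_N):\ P\prec P'\prec P''\}$. For $i\in\{\mathcal D,\mathcal M\}$, $F^i_{P,Q,s_2}(t_2)=\liminf_{n\to\infty}F^i\big(P^n\to Q^{\frac{H(P)}{H(Q)}n+t_2\sqrt n}\,\big|\,H(P)n+s_2\sqrt n\big)$ (only large $n$ matter). $\Phi_{\mu,v},\phi_{\mu,v}$ are the cumulative distribution function and density of the normal distribution with mean $\mu$ and variance $v$; $\Phi=\Phi_{0,1}$. For densities, $\mathcal F(p,q)=\int_{\mathbb R}\sqrt{p(x)q(x)}\,dx$. For $v>0$, $s\in\mathbb R$, $Z_{v,s}(\mu)=1-\sup_{A\in\mathcal A_s}\mathcal F\big(\frac{dA}{dx},\phi_{\mu,v}\big)^2$, where $\mathcal A_s$ is the set of continuously differentiable monotone increasing $A:\mathbb R\to[0,1]$ with $A(s)=1$ and $\Phi\le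 A\le1$. *)

theory Defs
  imports "HOL-Probability.Probability"
begin

text \<open>A distribution on a finite set \<open>X\<close> is a pmf \<open>P\<close> with \<open>set_pmf P \<subseteq> X\<close>.\<close>

definition distributions_on :: "'a set \<Rightarrow> 'a pmf set" where
  "distributions_on X = {P. set_pmf P \<subseteq> X}"

text \<open>Sums over the support implement the convention \<open>0 log 0 = 0\<close>.\<close>

definition shannon_entropy :: "'a pmf \<Rightarrow> real" where
  "shannon_entropy P = - (\<Sum>x\<in>set_pmf P. pmf P x * log 2 (pmf P x))"

definition varentropy :: "'a pmf \<Rightarrow> real" where
  "varentropy P = (\<Sum>x\<in>set_pmf P. pmf P x * (- log 2 (pmf P x) - shannon_entropy P)\<^sup>2)"

definition nonuniform :: "'a pmf \<Rightarrow> bool" where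
  "nonuniform P \<longleftrightarrow> P \<noteq> pmf_of_set (set_pmf P)"

lemma nonuniform_iff_varentropy_pos:
  assumes fin: "finite (set_pmf P)"
  shows "nonuniform P \<longleftrightarrow> varentropy P > 0"
proof -
  have ne: "set_pmf P \<noteq> {}" by (rule set_pmf_not_empty)
  have nonneg: "varentropy P \<ge> 0"
    unfolding varentropy_def by (intro sum_nonneg mult_nonneg_nonneg) auto
  have sum1: "(\<Sum>x\<in>set_pmf P. pmf P x) = 1"
    by (rule sum_pmf_eq_1[OF fin]) auto
  have "varentropy P = 0 \<longleftrightarrow> P = pmf_of_set (set_pmf P)"
  proof
    assume "varentropy P = 0"
    then have "\<forall>x\<in>set_pmf P. pmf P x * (- log 2 (pmf P x) - shannon_entropy P)\<^sup>2 = 0"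
      unfolding varentropy_def by (subst (asm) sum_nonneg_eq_0_iff) (auto simp: fin)
    then have lg: "log 2 (pmf P x) = - shannon_entropy P" if "x \<in> set_pmf P" for x
      using that by (auto simp: pmf_eq_0_set_pmf)
    define c where "c = 2 powr (- shannon_entropy P)"
    have c: "pmf P x = c" if "x \<in> set_pmf P" for x
      using lg[OF that] that unfolding c_def
      by (metis pmf_positive powr_log_cancel zero_less_numeral numeral_eq_one_iff semiring_norm(85))
    have "real (card (set_pmf P)) * c = 1"
      using sum1 c by simp
    then have cc: "c = 1 / real (card (set_pmf P))"
      using fin ne by (simp add: field_simps)
    show "P = pmf_of_set (set_pmf P)"
    proof (rule pmf_eqI)
      fix x
      show "pmf P x = pmf (pmf_of_set (set_pmf P)) x"
        using c[of x] cc fin ne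
        by (cases "x \<in> set_pmf P") (auto simp: pmf_eq_0_set_pmf)
    qed
  next
    assume u: "P = pmf_of_set (set_pmf P)"
    have pv: "pmf P x = 1 / real (card (set_pmf P))" if "x \<in> set_pmf P" for x
      using pmf_of_set[OF ne fin, of x] that u by simp
    let ?k = "real (card (set_pmf P))"
    have k: "?k > 0" using fin ne by (simp add: card_gt_0_iff)
    have "shannon_entropy P = - log 2 (1 / ?k)"
      unfolding shannon_entropy_def using pv k by simp
    then show "varentropy P = 0"
      unfolding varentropy_def using pv by simp
  qed
  then show ?thesis
    using nonneg by (auto simp: nonuniform_def)
qed

definition C_param :: "'a pmf \<Rightarrow> 'b pmf \<Rightarrow> real" where
  "C_param P Q = shannon_entropy P / varentropy P * inverse (shannon_entropy Q / varentropy Q)"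

definition D_param :: "'a pmf \<Rightarrow> 'b pmf \<Rightarrow> real" where
  "D_param P Q = shannon_entropy Q / sqrt (varentropy P)"

definition fidelity :: "'b set \<Rightarrow> 'b pmf \<Rightarrow> 'b pmf \<Rightarrow> real" where
  "fidelity Y Q Q' = (\<Sum>y\<in>Y. sqrt (pmf Q y) * sqrt (pmf Q' y))"

text \<open>
  The values of a finitely supported \<open>P\<close> in decreasing order, indexed from 0.  Elements of
  probability zero come last in this order, so listing only the support and padding with zeros
  gives the same sequence for every finite set carrying \<open>P\<close>.
\<close>

definition decreasing_values :: "'a pmf \<Rightarrow> nat \<Rightarrow> real" where
  "decreasing_values P i =
     (let xs = rev (sorted_list_of_multiset (image_mset (pmf P) (mset_set (set_pmf P))))
      in if i < length xs then xs ! i else 0)"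

definition majorized :: "'a pmf \<Rightarrow> 'b pmf \<Rightarrow> bool" (infix \<open>\<prec>\<^sub>m\<close> 50) where
  "P \<prec>\<^sub>m Q \<longleftrightarrow> (\<forall>l. (\<Sum>i<l. decreasing_values P i) \<le> (\<Sum>i<l. decreasing_values Q i))"

definition storage :: "real \<Rightarrow> nat set" where
  "storage N = {..<nat \<lfloor>2 powr N\<rfloor>}"

text \<open>The pushforward \<open>W_f(P)\<close> is \<open>map_pmf f P\<close>.\<close>

definition fidelity_D :: "'a set \<Rightarrow> 'a pmf \<Rightarrow> 'b set \<Rightarrow> 'b pmf \<Rightarrow> real \<Rightarrow> real" where
  "fidelity_D X P Y Q N =
     Sup {fidelity Y (map_pmf f' (map_pmf f P)) Q | f f'.
            f \<in> X \<rightarrow> storage N \<and> f' \<in> storage N \<rightarrow> Y}"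

definition fidelity_M :: "'a pmf \<Rightarrow> 'b set \<Rightarrow> 'b pmf \<Rightarrow> real \<Rightarrow> real" where
  "fidelity_M P Y Q N =
     Sup {fidelity Y P'' Q | P''. P'' \<in> distributions_on Y \<and>
            (\<exists>P'\<in>distributions_on (storage N). P \<prec>\<^sub>m P' \<and> P' \<prec>\<^sub>m P'')}"

text \<open>
  The \<open>n\<close>-fold product lives on the words of length \<open>n\<close>.  A real exponent is rounded down;
  for the finitely many \<open>n\<close> at which the exponent below is negative or the storage empty, the
  values are irrelevant to the limit inferior.
\<close>

definition words :: "'a set \<Rightarrow> nat \<Rightarrow> 'a list set" where
  "words X n = {xs. set xs \<subseteq> X \<and> length xs = n}"

definition target_length :: "'a pmf \<Rightarrow> 'b pmf \<Rightarrow> real \<Rightarrow> nat \<Rightarrow> nat" where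
  "target_length P Q t\<^sub>2 n =
     nat \<lfloor>shannon_entropy P / shannon_entropy Q * real n + t\<^sub>2 * sqrt (real n)\<rfloor>"

definition storage_bits :: "'a pmf \<Rightarrow> real \<Rightarrow> nat \<Rightarrow> real" where
  "storage_bits P s\<^sub>2 n = shannon_entropy P * real n + s\<^sub>2 * sqrt (real n)"

definition asymp_fidelity_D ::
    "'a set \<Rightarrow> 'a pmf \<Rightarrow> 'b set \<Rightarrow> 'b pmf \<Rightarrow> real \<Rightarrow> real \<Rightarrow> ereal" where
  "asymp_fidelity_D X P Y Q s\<^sub>2 t\<^sub>2 =
     liminf (\<lambda>n. ereal (fidelity_D
       (words X n) (replicate_pmf n P)
       (words Y (target_length P Q t\<^sub>2 n)) (replicate_pmf (target_length P Q t\<^sub>2 n) Q)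
       (storage_bits P s\<^sub>2 n)))"

definition asymp_fidelity_M ::
    "'a pmf \<Rightarrow> 'b set \<Rightarrow> 'b pmf \<Rightarrow> real \<Rightarrow> real \<Rightarrow> ereal" where
  "asymp_fidelity_M P Y Q s\<^sub>2 t\<^sub>2 =
     liminf (\<lambda>n. ereal (fidelity_M
       (replicate_pmf n P)
       (words Y (target_length P Q t\<^sub>2 n)) (replicate_pmf (target_length P Q t\<^sub>2 n) Q)
       (storage_bits P s\<^sub>2 n)))"

abbreviation std_normal_cdf :: "real \<Rightarrow> real" where
  "std_normal_cdf \<equiv> cdf std_normal_distribution"

definition density_fidelity :: "(real \<Rightarrow> real) \<Rightarrow> (real \<Rightarrow> real) \<Rightarrow> real" where
  "density_fidelity p q = (LINT x|lborel. sqrt (p x * q x))"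

definition admissible_cdfs :: "real \<Rightarrow> (real \<Rightarrow> real) set" where
  "admissible_cdfs s = {A. A C1_differentiable_on UNIV \<and> mono A \<and> range A \<subseteq> {0..1} \<and> A s = 1 \<and>
     (\<forall>x. std_normal_cdf x \<le> A x \<and> A x \<le> 1)}"

text \<open>\<open>normal_density\<close> takes the standard deviation, whereas \<open>v\<close> is the variance.\<close>

definition Z_dist :: "real \<Rightarrow> real \<Rightarrow> real \<Rightarrow> real" where
  "Z_dist v s \<mu> =
     1 - (SUP A\<in>admissible_cdfs s. (density_fidelity (deriv A) (normal_density \<mu> (sqrt v)))\<^sup>2)"

text \<open>
  The filter of non-uniform distributions on \<open>X\<close> tending to \<open>P\<^sub>0\<close>: the topology on the mass
  functions is the product topology, that is, pointwise convergence.
\<close>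

definition nonuniform_nhds :: "'a set \<Rightarrow> 'a pmf \<Rightarrow> 'a pmf filter" where
  "nonuniform_nhds X P\<^sub>0 =
     inf (filtercomap pmf (nhds (pmf P\<^sub>0))) (principal {P \<in> distributions_on X. nonuniform P})"

lemma tendsto_nonuniform_nhds_iff:
  "filterlim f (nonuniform_nhds X P\<^sub>0) F \<longleftrightarrow>
     (\<forall>x. ((\<lambda>k. pmf (f k) x) \<longlongrightarrow> pmf P\<^sub>0 x) F) \<and>
     (\<forall>\<^sub>F k in F. f k \<in> distributions_on X \<and> nonuniform (f k))"
proof -
  have "((\<lambda>k. pmf (f k)) \<longlongrightarrow> pmf P\<^sub>0) F \<longleftrightarrow> (\<forall>x. ((\<lambda>k. pmf (f k) x) \<longlongrightarrow> pmf P\<^sub>0 x) F)"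
    using limitin_componentwise[of "\<lambda>_. euclidean :: real topology" UNIV "\<lambda>k. pmf (f k)" "pmf P\<^sub>0" F]
    by (simp add: euclidean_product_topology flip: limitin_canonical_iff)
  then show ?thesis
    unfolding nonuniform_nhds_def filterlim_inf filterlim_filtercomap_iff filterlim_principal
    by (simp add: o_def)
qed

lemma nonuniform_nhds_neq_bot:
  assumes fin: "finite X" and card: "card X \<ge> 2"
  shows "nonuniform_nhds X (pmf_of_set X) \<noteq> bot"
proof -
  obtain a b where ab: "a \<in> X" "b \<in> X" "a \<noteq> b"
    using card by (metis card_le_Suc0_iff_eq fin not_less_eq_eq numeral_2_eq_2)
  have ne: "X \<noteq> {}" using ab by auto
  define e where "e k = inverse (real (Suc (Suc k)))" for k
  have e: "0 < e k" "e k < 1" for k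
    unfolding e_def by (auto simp: field_simps)
  define f where "f k = bind_pmf (bernoulli_pmf (e k)) (\<lambda>t. if t then return_pmf a else pmf_of_set X)" for k
  have pf: "pmf (f k) x = e k * indicator {a} x + (1 - e k) * pmf (pmf_of_set X) x" for k x
    using e[of k] unfolding f_def pmf_bind by (simp add: indicator_def)
  have "pmf (f k) a \<noteq> pmf (f k) b" for k
    using ab e[of k] fin ne by (simp add: pf)
  moreover have sf: "set_pmf (f k) = X" for k
  proof (intro equalityI subsetI)
    fix x assume "x \<in> set_pmf (f k)"
    then show "x \<in> X"
      using ab fin ne by (auto simp: set_pmf_iff pf indicator_def split: if_splits)
  next
    fix x assume x: "x \<in> X"
    have "0 < (1 - e k) * pmf (pmf_of_set X) x"
      using x e[of k] fin ne by (simp add: card_gt_0_iff)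
    moreover have "0 \<le> e k * indicator {a} x" using e[of k] by simp
    ultimately show "x \<in> set_pmf (f k)"
      unfolding set_pmf_iff pf by linarith
  qed
  ultimately have nu: "nonuniform (f k)" for k
    using ab fin ne unfolding nonuniform_def sf by (metis pmf_of_set indicator_simps(1))
  have e0: "e \<longlonglongrightarrow> 0"
    unfolding e_def using LIMSEQ_inverse_real_of_nat LIMSEQ_Suc by blast
  have "(\<lambda>k. pmf (f k) x) \<longlonglongrightarrow> 0 * indicator {a} x + (1 - 0) * pmf (pmf_of_set X) x" for x
    unfolding pf by (intro tendsto_intros e0)
  then have "filterlim f (nonuniform_nhds X (pmf_of_set X)) sequentially"
    unfolding tendsto_nonuniform_nhds_iff using nu sf by (simp add: distributions_on_def)
  then show ?thesis
    by (metis bot.extremum_unique filterlim_def filtermap_bot_iff trivial_limit_sequentially)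
qed

end

theory Submission
  imports Defs
begin

text \<open>
  Write \<open>M\<close> for the smaller of the number of words of length \<open>n\<close> and the size of the storage.
  Whatever passes through the storage is supported on at most \<open>M\<close> words, since majorization
  cannot enlarge the support; hence its squared fidelity to \<open>R = Q\<^sup>m\<close> is at most
  the \<open>R\<close>-probability of \<open>M\<close> words, which is at most \<open>R{R \<ge> \<gamma> / M} + \<gamma>\<close>.  Conversely, if
  \<open>A = {R \<ge> \<Gamma> / M}\<close> with \<open>\<Gamma>\<close> large, a deterministic map can produce \<open>R\<close> conditioned on \<open>A\<close> up to
  a relative rounding error \<open>1 / \<Gamma>\<close>, and the conditioned distribution has squared fidelity \<open>R(A)\<close>.
  By the central limit theorem all these probabilities have the same limit, because the constants
  \<open>\<gamma>\<close> and \<open>\<Gamma>\<close> vanish after division by the square root of \<open>n\<close>.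

  For the limit of \<open>Z\<close>, rescale the line by \<open>\<sigma>\<close>, the square root of the varentropy of \<open>P\<close>.  The
  constraint \<open>\<Phi> \<le> A\<close> then degenerates to \<open>A = 1\<close> on the positive half-line, so that the optimal
  curve approaches the Gaussian conditioned on \<open>{..min s 0}\<close>.
\<close>

section \<open>Majorization and one-shot fidelities\<close>

text \<open>Induction by removing the largest index \<open>m\<close>: in a set of
  \<open>k + 1\<close> indices it is at least \<open>k\<close>, so \<open>a m\<close> is at most
  \<open>a k\<close>.\<close>

lemma sum_antimono_le_sum_lessThan_card:
  fixes a :: "nat \<Rightarrow> real"
  assumes "antimono a" "finite T"
  shows "sum a T \<le> sum a {..<card T}"
  using assms(2)
proof (induction "card T" arbitrary: T)
  case 0
  then show ?case by simp
next
  case (Suc k)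
  then have ne: "T \<noteq> {}" by auto
  define m where "m = Max T"
  have m: "m \<in> T" using ne Suc.prems by (simp add: m_def)
  have "T \<subseteq> {..m}" using Suc.prems by (auto simp: m_def)
  then have "card T \<le> Suc m" by (metis card_atMost card_mono finite_atMost)
  then have km: "k \<le> m" using Suc.hyps by simp
  have ck: "card (T - {m}) = k" using Suc m by simp
  have "sum a T = a m + sum a (T - {m})" using m Suc.prems by (simp add: sum.remove)
  also have "\<dots> \<le> a k + sum a {..<k}"
    using Suc.hyps(1)[of "T - {m}"] ck Suc.prems antimonoD[OF assms(1) km] by simp
  finally show ?case by (simp flip: Suc.hyps(2))
qed

text \<open>Exposes a list of the support behind the sorted multiset, so that sums over indices can
  be exchanged with sums over points.\<close>

lemma decreasing_values_enumeration:
  assumes fin: "finite (set_pmf P)"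
  obtains ys where "distinct ys" "set ys = set_pmf P" "antimono (decreasing_values P)"
    "\<And>i. decreasing_values P i = (if i < length ys then pmf P (ys ! i) else 0)"
proof -
  obtain zs where zs: "set zs = set_pmf P" "distinct zs"
    using finite_distinct_list[OF fin] by auto
  define ys where "ys = rev (sort_key (pmf P) zs)"
  have "sorted_list_of_multiset (image_mset (pmf P) (mset_set (set_pmf P))) = sort (map (pmf P) zs)"
    using zs by (metis mset_map mset_set_set sorted_list_of_multiset_mset)
  also have "\<dots> = map (pmf P) (sort_key (pmf P) zs)"
    by (rule properties_for_sort) (auto intro: sorted_sort_key)
  finally have xs: "rev (sorted_list_of_multiset (image_mset (pmf P) (mset_set (set_pmf P)))) = map (pmf P) ys"
    by (simp add: ys_def rev_map)
  have dv: "decreasing_values P i = (if i < length ys then pmf P (ys ! i) else 0)" for i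
    unfolding decreasing_values_def xs by simp
  have srt: "sorted_wrt (\<ge>) (map (pmf P) ys)"
    unfolding ys_def by (simp add: sorted_wrt_rev rev_map[symmetric] del: rev_map)
  have "decreasing_values P j \<le> decreasing_values P i" if "i \<le> j" for i j
  proof (cases "j < length ys \<and> i < j")
    case True
    then show ?thesis using sorted_wrt_nth_less[OF srt, of i j] that by (simp add: dv)
  next
    case False
    then show ?thesis using that by (cases "i = j") (auto simp: dv)
  qed
  then have "antimono (decreasing_values P)" by (simp add: antimono_def)
  then show thesis
    using that[of ys] zs dv by (simp add: ys_def)
qed

lemma decreasing_values_nonneg:
  assumes "finite (set_pmf P)"
  shows "decreasing_values P i \<ge> 0"
  by (rule decreasing_values_enumeration[OF assms]) auto

text \<open>Points of \<open>B\<close> outside the support contribute nothing; the others occupy at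
  most \<open>k\<close> indices. Together with \<open>sum_decreasing_values_attained\<close> this
  describes partial sums as maximal probabilities of small sets, the form in which majorization is
  used below.\<close>

lemma measure_pmf_le_sum_decreasing_values:
  assumes fin: "finite (set_pmf P)" and B: "finite B" "card B \<le> k"
  shows "measure_pmf.prob P B \<le> (\<Sum>i<k. decreasing_values P i)"
proof -
  obtain ys where ys: "distinct ys" "set ys = set_pmf P" "antimono (decreasing_values P)"
    "\<And>i. decreasing_values P i = (if i < length ys then pmf P (ys ! i) else 0)"
    using decreasing_values_enumeration[OF fin] by metis
  define T where "T = {i. i < length ys \<and> ys ! i \<in> B}"
  have finT: "finite T" by (simp add: T_def)
  have inj: "inj_on ((!) ys) T"
    using ys(1) by (auto simp: inj_on_def T_def nth_eq_iff_index_eq)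
  have img: "(!) ys ` T = B \<inter> set_pmf P"
    unfolding ys(2)[symmetric] by (auto simp: T_def set_conv_nth)
  have cT: "card T \<le> k"
    using card_image[OF inj] card_mono[OF B(1), of "B \<inter> set_pmf P"] B(2) by (simp add: img)
  have "measure_pmf.prob P B = measure_pmf.prob P (B \<inter> set_pmf P)"
    by (simp add: measure_Int_set_pmf)
  also have "\<dots> = sum (pmf P) ((!) ys ` T)"
    using B by (simp add: measure_measure_pmf_finite img)
  also have "\<dots> = (\<Sum>i\<in>T. decreasing_values P i)"
    by (subst sum.reindex[OF inj]) (auto simp: ys(4) T_def intro!: sum.cong)
  also have "\<dots> \<le> (\<Sum>i<card T. decreasing_values P i)"
    by (rule sum_antimono_le_sum_lessThan_card[OF ys(3) finT])
  also have "\<dots> \<le> (\<Sum>i<k. decreasing_values P i)"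
    using cT by (intro sum_mono2) (auto simp: decreasing_values_nonneg[OF fin])
  finally show ?thesis .
qed

lemma sum_decreasing_values_attained:
  assumes fin: "finite (set_pmf P)"
  obtains B where "finite B" "card B \<le> k" "(\<Sum>i<k. decreasing_values P i) = measure_pmf.prob P B"
proof -
  obtain ys where ys: "distinct ys" "set ys = set_pmf P"
    "\<And>i. decreasing_values P i = (if i < length ys then pmf P (ys ! i) else 0)"
    using decreasing_values_enumeration[OF fin] by metis
  have "measure_pmf.prob P (set (take k ys)) = (\<Sum>y\<leftarrow>take k ys. pmf P y)"
    using ys(1) by (simp add: measure_measure_pmf_finite sum_list_distinct_conv_sum_set)
  also have "\<dots> = (\<Sum>i<min k (length ys). pmf P (ys ! i))"
    by (simp add: sum_list_sum_nth atLeast0LessThan min.commute)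
  also have "\<dots> = (\<Sum>i<min k (length ys). decreasing_values P i)"
    by (simp add: ys(3))
  also have "\<dots> = (\<Sum>i<k. decreasing_values P i)"
    by (rule sum.mono_neutral_left) (auto simp: ys(3))
  moreover have "card (set (take k ys)) \<le> k"
    using card_length[of "take k ys"] by simp
  ultimately show thesis using that[of "set (take k ys)"] by simp
qed

text \<open>If \<open>B\<close> attains the partial sum for \<open>P\<close>, its image has no more
  points than \<open>B\<close>, and the preimage of that image contains \<open>B\<close>. Merging
  points therefore only increases partial sums.\<close>

lemma majorized_map_pmf:
  assumes fin: "finite (set_pmf P)"
  shows "P \<prec>\<^sub>m map_pmf f P"
  unfolding majorized_def
proof
  fix k
  obtain B where B: "finite B" "card B \<le> k" "(\<Sum>i<k. decreasing_values P i) = measure_pmf.prob P B"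
    using sum_decreasing_values_attained[OF fin] by metis
  have "measure_pmf.prob P B \<le> measure_pmf.prob (map_pmf f P) (f ` B)"
    unfolding measure_map_pmf by (intro measure_pmf.finite_measure_mono) auto
  also have "\<dots> \<le> (\<Sum>i<k. decreasing_values (map_pmf f P) i)"
    using B fin card_image_le[OF B(1), of f]
    by (intro measure_pmf_le_sum_decreasing_values) auto
  finally show "(\<Sum>i<k. decreasing_values P i) \<le> (\<Sum>i<k. decreasing_values (map_pmf f P) i)"
    using B by simp
qed

text \<open>With \<open>k\<close> the support size of \<open>P\<close>, the partial sum of
  \<open>P\<close> is already 1, so some set of at most \<open>k\<close> points carries all of
  \<open>P'\<close>.\<close>

lemma majorized_card_set_pmf_le:
  assumes fin: "finite (set_pmf P)" "finite (set_pmf P')" and maj: "P \<prec>\<^sub>m P'"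
  shows "card (set_pmf P') \<le> card (set_pmf P)"
proof -
  let ?k = "card (set_pmf P)"
  obtain B where B: "finite B" "card B \<le> ?k" "(\<Sum>i<?k. decreasing_values P' i) = measure_pmf.prob P' B"
    using sum_decreasing_values_attained[OF fin(2)] by metis
  have "measure_pmf.prob P (set_pmf P) = 1"
    by (simp add: measure_pmf.prob_eq_1 AE_measure_pmf)
  then have "1 \<le> (\<Sum>i<?k. decreasing_values P i)"
    using measure_pmf_le_sum_decreasing_values[OF fin(1) fin(1), of ?k] by simp
  also have "\<dots> \<le> measure_pmf.prob P' B"
    using maj B(3) by (metis majorized_def)
  finally have "measure_pmf.prob P' B = 1"
    using measure_pmf.prob_le_1[of P' B] by linarith
  then have "AE y in P'. y \<in> B"
    using measure_pmf.AE_prob_1 by blast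
  then have "set_pmf P' \<subseteq> B"
    unfolding AE_measure_pmf_iff by blast
  from card_mono[OF B(1) this] B(2) show ?thesis by linarith
qed

section \<open>Fidelity bounds by threshold probabilities of the target\<close>

lemma fidelity_nonneg: "fidelity Y P Q \<ge> 0"
  unfolding fidelity_def by (intro sum_nonneg) auto

text \<open>Cauchy-Schwarz on the part of the support of \<open>P\<close> inside \<open>Y\<close>,
  where \<open>P\<close> has mass at most 1.\<close>

lemma fidelity_le_sqrt_prob_set_pmf:
  assumes finY: "finite Y"
  shows "fidelity Y P Q \<le> sqrt (measure_pmf.prob Q (set_pmf P))"
proof -
  let ?S = "Y \<inter> set_pmf P"
  have "fidelity Y P Q = (\<Sum>y\<in>?S. sqrt (pmf P y) * sqrt (pmf Q y))"
    unfolding fidelity_def using finY by (intro sum.mono_neutral_right) (auto simp: set_pmf_iff)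
  moreover have "(\<Sum>y\<in>?S. sqrt (pmf P y) * sqrt (pmf Q y))\<^sup>2
      \<le> (\<Sum>y\<in>?S. (sqrt (pmf P y))\<^sup>2) * (\<Sum>y\<in>?S. (sqrt (pmf Q y))\<^sup>2)"
    by (rule Cauchy_Schwarz_ineq_sum)
  moreover have "\<dots> = measure_pmf.prob P ?S * measure_pmf.prob Q ?S"
    using finY by (simp add: measure_measure_pmf_finite)
  moreover have "\<dots> \<le> 1 * measure_pmf.prob Q (set_pmf P)"
    by (intro mult_mono measure_pmf.finite_measure_mono) auto
  ultimately have "(fidelity Y P Q)\<^sup>2 \<le> measure_pmf.prob Q (set_pmf P)" by simp
  then show ?thesis by (rule real_le_rsqrt)
qed

lemma fidelity_le_1:
  assumes "finite Y"
  shows "fidelity Y P Q \<le> 1"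
  using fidelity_le_sqrt_prob_set_pmf[OF assms, of P Q]
  by (rule order_trans) simp

text \<open>The points of \<open>B\<close> below the threshold weigh at most \<theta> each; all
  others lie in the threshold set.\<close>

lemma prob_le_prob_pmf_ge_add:
  fixes \<theta> :: real
  assumes "finite B" "\<theta> \<ge> 0"
  shows "measure_pmf.prob Q B \<le> measure_pmf.prob Q {y. \<theta> \<le> pmf Q y} + card B * \<theta>"
proof -
  have "measure_pmf.prob Q B \<le> measure_pmf.prob Q ({y. \<theta> \<le> pmf Q y} \<union> {y\<in>B. pmf Q y < \<theta>})"
    by (intro measure_pmf.finite_measure_mono) auto
  also have "\<dots> \<le> measure_pmf.prob Q {y. \<theta> \<le> pmf Q y} + measure_pmf.prob Q {y\<in>B. pmf Q y < \<theta>}"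
    by (rule measure_Un_le) auto
  also have "measure_pmf.prob Q {y\<in>B. pmf Q y < \<theta>} = (\<Sum>y\<in>{y\<in>B. pmf Q y < \<theta>}. pmf Q y)"
    using assms by (simp add: measure_measure_pmf_finite)
  also have "\<dots> \<le> (\<Sum>y\<in>{y\<in>B. pmf Q y < \<theta>}. \<theta>)" by (intro sum_mono) auto
  also have "\<dots> \<le> card B * \<theta>"
    using assms by (auto intro!: mult_right_mono card_mono)
  finally show ?thesis by simp
qed

text \<open>One-shot converse. Majorization hands the support bound \<open>M\<close> down to
  \<open>P''\<close>, and Cauchy-Schwarz bounds the squared fidelity by the
  \<open>Q\<close>-probability of that support. The threshold \<open>\<gamma> / M\<close> limits the
  total cost of light points to \<gamma>.\<close>

lemma fidelity_M_le:
  assumes finP: "finite (set_pmf P)" and finY: "finite Y" and ne: "Y \<noteq> {}" "storage N \<noteq> {}"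
    and M: "M = min (card (set_pmf P)) (card (storage N))" and \<gamma>: "\<gamma> \<ge> 0"
  shows "fidelity_M P Y Q N \<le> sqrt (measure_pmf.prob Q {y. \<gamma> / M \<le> pmf Q y} + \<gamma>)"
  unfolding fidelity_M_def
proof (rule cSup_least)
  \<comment> \<open>Point masses show that the set under the supremum is nonempty, as
    \<open>cSup_least\<close> requires.\<close>
  obtain y where y: "y \<in> Y" using ne by auto
  obtain i where i: "i \<in> storage N" using ne by auto
  have "P \<prec>\<^sub>m return_pmf i" "return_pmf i \<prec>\<^sub>m return_pmf y"
    using majorized_map_pmf[OF finP, of "\<lambda>_. i"] majorized_map_pmf[of "return_pmf i" "\<lambda>_. y"] by simp_all
  moreover have "return_pmf y \<in> distributions_on Y" "return_pmf i \<in> distributions_on (storage N)"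
    using y i by (simp_all add: distributions_on_def)
  ultimately show "{fidelity Y P'' Q | P''. P'' \<in> distributions_on Y \<and>
            (\<exists>P'\<in>distributions_on (storage N). P \<prec>\<^sub>m P' \<and> P' \<prec>\<^sub>m P'')} \<noteq> {}"
    by blast
next
  fix F assume "F \<in> {fidelity Y P'' Q | P''. P'' \<in> distributions_on Y \<and>
            (\<exists>P'\<in>distributions_on (storage N). P \<prec>\<^sub>m P' \<and> P' \<prec>\<^sub>m P'')}"
  then obtain P' P'' where F: "F = fidelity Y P'' Q" and P'': "set_pmf P'' \<subseteq> Y"
    and P': "set_pmf P' \<subseteq> storage N" "P \<prec>\<^sub>m P'" "P' \<prec>\<^sub>m P''"
    by (auto simp: distributions_on_def)
  have finS: "finite (storage N)" by (simp add: storage_def)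
  have fin: "finite (set_pmf P')" "finite (set_pmf P'')"
    using P' P'' finY finS by (auto intro: finite_subset)
  have "card (set_pmf P'') \<le> card (set_pmf P')"
    using majorized_card_set_pmf_le P'(3) fin by blast
  moreover have "card (set_pmf P') \<le> card (set_pmf P)"
    using majorized_card_set_pmf_le P'(2) fin finP by blast
  moreover have "card (set_pmf P') \<le> card (storage N)"
    using card_mono[OF finS P'(1)] .
  ultimately have c: "card (set_pmf P'') \<le> M" unfolding M by linarith
  then have M0: "M > 0" using fin(2) set_pmf_not_empty[of P''] by (metis card_gt_0_iff less_le_trans)
  have "measure_pmf.prob Q (set_pmf P'')
      \<le> measure_pmf.prob Q {y. \<gamma> / M \<le> pmf Q y} + card (set_pmf P'') * (\<gamma> / M)"
    using fin \<gamma> by (intro prob_le_prob_pmf_ge_add) auto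
  moreover have "card (set_pmf P'') * (\<gamma> / M) \<le> M * (\<gamma> / M)"
    using c \<gamma> by (intro mult_right_mono) auto
  moreover have "M * (\<gamma> / M) = \<gamma>" using M0 by simp
  ultimately have "measure_pmf.prob Q (set_pmf P'') \<le> measure_pmf.prob Q {y. \<gamma> / M \<le> pmf Q y} + \<gamma>"
    by linarith
  then show "F \<le> sqrt (measure_pmf.prob Q {y. \<gamma> / M \<le> pmf Q y} + \<gamma>)"
    unfolding F by (intro order_trans[OF fidelity_le_sqrt_prob_set_pmf[OF finY]] real_sqrt_le_mono)
qed

text \<open>Pushing forward only moves up in the majorization order, so each pair of deterministic
  maps gives an admissible majorization chain and the right-hand supremum runs over a larger
  set.\<close>

lemma fidelity_D_le_fidelity_M:
  assumes finX: "finite X" "set_pmf P \<subseteq> X" and finY: "finite Y" and ne: "Y \<noteq> {}" "storage N \<noteq> {}"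
  shows "fidelity_D X P Y Q N \<le> fidelity_M P Y Q N"
  unfolding fidelity_D_def fidelity_M_def
proof (rule cSup_subset_mono)
  obtain y where y: "y \<in> Y" using ne by auto
  obtain i where i: "i \<in> storage N" using ne by auto
  have "(\<lambda>_. i) \<in> X \<rightarrow> storage N" "(\<lambda>_. y) \<in> storage N \<rightarrow> Y"
    using y i by simp_all
  then show "{fidelity Y (map_pmf f' (map_pmf f P)) Q | f f'.
            f \<in> X \<rightarrow> storage N \<and> f' \<in> storage N \<rightarrow> Y} \<noteq> {}"
    by blast
  show "bdd_above {fidelity Y P'' Q | P''. P'' \<in> distributions_on Y \<and>
            (\<exists>P'\<in>distributions_on (storage N). P \<prec>\<^sub>m P' \<and> P' \<prec>\<^sub>m P'')}"
    using fidelity_le_1[OF finY] by (intro bdd_aboveI[of _ 1]) auto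
  have finP: "finite (set_pmf P)" using finX finite_subset by blast
  show "{fidelity Y (map_pmf f' (map_pmf f P)) Q | f f'.
            f \<in> X \<rightarrow> storage N \<and> f' \<in> storage N \<rightarrow> Y}
    \<subseteq> {fidelity Y P'' Q | P''. P'' \<in> distributions_on Y \<and>
            (\<exists>P'\<in>distributions_on (storage N). P \<prec>\<^sub>m P' \<and> P' \<prec>\<^sub>m P'')}"
  proof clarify
    fix f :: "'a \<Rightarrow> nat" and f' :: "nat \<Rightarrow> 'b"
    assume f: "f \<in> X \<rightarrow> storage N" "f' \<in> storage N \<rightarrow> Y"
    have "map_pmf f P \<in> distributions_on (storage N)" "map_pmf f' (map_pmf f P) \<in> distributions_on Y"
      using f finX by (auto simp: distributions_on_def)
    moreover have "P \<prec>\<^sub>m map_pmf f P" "map_pmf f P \<prec>\<^sub>m map_pmf f' (map_pmf f P)"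
      using finP by (auto intro!: majorized_map_pmf)
    ultimately show "\<exists>P''. fidelity Y (map_pmf f' (map_pmf f P)) Q = fidelity Y P'' Q \<and> P'' \<in> distributions_on Y \<and>
            (\<exists>P'\<in>distributions_on (storage N). P \<prec>\<^sub>m P' \<and> P' \<prec>\<^sub>m P'')"
      by blast
  qed
qed

text \<open>Disjoint blocks of \<open>n y\<close> elements are split off one point at a time;
  surplus elements of \<open>W\<close> all go to the last point. This turns integer quotas into a
  deterministic map.\<close>

lemma exists_map_with_large_fibres:
  fixes n :: "'b \<Rightarrow> nat"
  assumes "finite A" "A \<noteq> {}" "finite W" "sum n A \<le> card W"
  shows "\<exists>g\<in>W \<rightarrow> A. \<forall>y\<in>A. n y \<le> card {w\<in>W. g w = y}"
  using assms
proof (induction A arbitrary: W rule: finite_ne_induct)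
  case (singleton y)
  then show ?case by (intro bexI[of _ "\<lambda>_. y"]) auto
next
  case (insert y A)
  then have "n y \<le> card W" by simp
  then obtain U where U: "U \<subseteq> W" "card U = n y" by (metis obtain_subset_with_card_n)
  have finU: "finite U" using U insert.prems finite_subset by blast
  have "sum n A \<le> card (W - U)"
    using insert U by (simp add: card_Diff_subset[OF finU])
  then obtain g where g: "g \<in> W - U \<rightarrow> A" "\<forall>y\<in>A. n y \<le> card {w\<in>W - U. g w = y}"
    using insert.IH[of "W - U"] insert.prems by auto
  define g' where "g' w = (if w \<in> U then y else g w)" for w
  have "n z \<le> card {w\<in>W. g' w = z}" if z: "z \<in> insert y A" for z
  proof (cases "z = y")
    case True
    have "U \<subseteq> {w\<in>W. g' w = z}" using U True by (auto simp: g'_def)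
    then have "card U \<le> card {w\<in>W. g' w = z}" using insert.prems by (intro card_mono) auto
    then show ?thesis using U True by simp
  next
    case False
    have "{w\<in>W - U. g w = z} \<subseteq> {w\<in>W. g' w = z}" by (auto simp: g'_def)
    then have "card {w\<in>W - U. g w = z} \<le> card {w\<in>W. g' w = z}" using insert.prems by (intro card_mono) auto
    then show ?thesis using g z False by force
  qed
  moreover have "g' \<in> W \<rightarrow> insert y A" using g by (auto simp: g'_def Pi_iff)
  ultimately show ?case by blast
qed

text \<open>One-shot achievability. Atoms of mass at least \<open>\<Gamma> / M\<close> are few
  enough to fit into the storage, and heavy enough that each receives a quota of at least \<Gamma>
  before rounding.\<close>

lemma fidelity_D_ge:
  assumes finX: "finite X" "X \<noteq> {}" and finY: "finite Y" "Y \<noteq> {}" and Q: "set_pmf Q \<subseteq> Y"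
    and ne: "storage N \<noteq> {}"
    and M: "M = min (card X) (card (storage N))" and \<Gamma>: "\<Gamma> \<ge> 1"
  shows "sqrt ((1 - 1 / \<Gamma>) * measure_pmf.prob Q {y. \<Gamma> / M \<le> pmf Q y})
    \<le> fidelity_D X (pmf_of_set X) Y Q N"
proof -
  define A where "A = {y. \<Gamma> / M \<le> pmf Q y}"
  define q where "q = measure_pmf.prob Q A"
  let ?D = "{fidelity Y (map_pmf f' (map_pmf f (pmf_of_set X))) Q | f f'.
            f \<in> X \<rightarrow> storage N \<and> f' \<in> storage N \<rightarrow> Y}"
  have bdd: "bdd_above ?D"
    using fidelity_le_1[OF finY(1)] by (intro bdd_aboveI[of _ 1]) auto
  have finS: "finite (storage N)" by (simp add: storage_def)
  have M0: "M > 0" using finX finS ne by (auto simp: M card_gt_0_iff)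
  have K0: "card X > 0" using finX by (simp add: card_gt_0_iff)
  have pos: "pmf Q y > 0" if "y \<in> A" for y
  proof -
    have "0 < \<Gamma> / M" using \<Gamma> M0 by simp
    then show ?thesis using that by (auto simp: A_def)
  qed
  have AY: "A \<subseteq> Y" using pos Q by (auto simp: set_pmf_iff less_le)
  have finA: "finite A" using AY finY finite_subset by blast
  have qsum: "q = sum (pmf Q) A" by (simp add: q_def finA measure_measure_pmf_finite)
  show ?thesis
  proof (cases "A = {}")
    case True
    obtain y where y: "y \<in> Y" using finY by auto
    obtain i where i: "i \<in> storage N" using ne by auto
    have "fidelity Y (map_pmf (\<lambda>_. y) (map_pmf (\<lambda>_. i) (pmf_of_set X))) Q \<in> ?D"
      using y i by blast
    from order_trans[OF fidelity_nonneg cSup_upper[OF this bdd]]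
    have "0 \<le> fidelity_D X (pmf_of_set X) Y Q N"
      unfolding fidelity_D_def .
    moreover have "measure_pmf.prob Q {y. \<Gamma> / M \<le> pmf Q y} = 0"
      using True unfolding A_def by simp
    ultimately show ?thesis by simp
  next
    case False
    then have q0: "q > 0" unfolding qsum using finA pos by (intro sum_pos) auto
    \<comment> \<open>Quotas of source points: the mass of \<open>y\<close> conditioned on
      \<open>A\<close>, scaled by \<open>card X\<close> and rounded down.\<close>
    define n where "n y = nat \<lfloor>card X * pmf Q y / q\<rfloor>" for y
    have "real (sum n A) \<le> (\<Sum>y\<in>A. card X * pmf Q y / q)"
      unfolding of_nat_sum using q0 by (intro sum_mono) (simp add: n_def)
    also have "\<dots> = card X"
      using q0 by (simp add: qsum flip: sum_divide_distrib sum_distrib_left)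
    finally have "sum n A \<le> card X" unfolding of_nat_le_iff .
    from exists_map_with_large_fibres[OF finA False finX(1) this]
    obtain g where g: "g \<in> X \<rightarrow> A" "\<And>y. y \<in> A \<Longrightarrow> n y \<le> card {x\<in>X. g x = y}" by blast
    \<comment> \<open>The atoms of \<open>A\<close> weigh at least \<open>\<Gamma> / M\<close> each
      and at most 1 together, so \<open>A\<close> has at most \<open>M\<close> points and can be
      encoded injectively.\<close>
    have "card A * (\<Gamma> / M) \<le> q"
    proof -
      have "card A * (\<Gamma> / M) = (\<Sum>y\<in>A. \<Gamma> / M)" by simp
      also have "\<dots> \<le> q" unfolding qsum by (intro sum_mono) (simp add: A_def)
      finally show ?thesis .
    qed
    also have "q \<le> 1" by (simp add: q_def)
    finally have "card A * \<Gamma> \<le> M" using M0 by (simp add: field_simps)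
    moreover have "real (card A) * 1 \<le> card A * \<Gamma>" using \<Gamma> by (intro mult_left_mono) auto
    ultimately have "real (card A) \<le> real M" by linarith
    then have "card A \<le> card (storage N)" by (simp add: M)
    then obtain h where h: "h ` A \<subseteq> storage N" "inj_on h A"
      using card_le_inj[OF finA finS] by blast
    obtain y0 where y0: "y0 \<in> A" using False by auto
    \<comment> \<open>The decoder inverts \<open>h\<close> on the codewords; the default
      \<open>y0\<close> keeps it inside \<open>Y\<close> elsewhere.\<close>
    define h' where "h' s = (if s \<in> h ` A then inv_into A h s else y0)" for s
    have h': "h' \<in> storage N \<rightarrow> Y"
      using y0 subsetD[OF AY] by (auto simp: h'_def h(2))
    have hg: "h \<circ> g \<in> X \<rightarrow> storage N" using h(1) g(1) by (auto simp: Pi_iff image_subset_iff)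
    have "map_pmf h' (map_pmf (h \<circ> g) (pmf_of_set X)) = map_pmf g (pmf_of_set X)"
      unfolding pmf.map_comp
      by (rule pmf.map_cong0) (use finX g h in \<open>auto simp: h'_def Pi_iff\<close>)
    then have inD: "fidelity Y (map_pmf g (pmf_of_set X)) Q \<in> ?D"
      using h' hg by (smt (verit, best) mem_Collect_eq)
    have pg: "(1 - 1 / \<Gamma>) * (pmf Q y / q) \<le> pmf (map_pmf g (pmf_of_set X)) y" if y: "y \<in> A" for y
    proof -
      define x where "x = card X * pmf Q y / q"
      have "\<Gamma> \<le> M * pmf Q y" using y M0 by (simp add: A_def field_simps)
      also have "\<dots> \<le> card X * pmf Q y" by (intro mult_right_mono) (auto simp: M)
      also have "\<dots> \<le> x"
      proof -
        have "x * q = card X * pmf Q y" using q0 by (simp add: x_def)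
        moreover have "x * q \<le> x * 1" using \<open>q \<le> 1\<close> q0 by (intro mult_left_mono) (auto simp: x_def)
        ultimately show ?thesis by simp
      qed
      finally have "\<Gamma> \<le> x" .
      \<comment> \<open>Rounding down loses at most 1, hence at most the fraction
        \<open>1 / \<Gamma>\<close> of the quota.\<close>
      then have "1 \<le> x / \<Gamma>" using \<Gamma> by simp
      then have "(1 - 1 / \<Gamma>) * x \<le> x - 1" by (simp add: algebra_simps)
      also have "\<dots> \<le> real (n y)" unfolding n_def x_def[symmetric] by linarith
      also have "\<dots> \<le> real (card {x\<in>X. g x = y})" using g(2)[OF y] by simp
      finally have "(1 - 1 / \<Gamma>) * x / card X \<le> real (card {x\<in>X. g x = y}) / card X"
        by (rule divide_right_mono) simp
      moreover have "pmf (map_pmf g (pmf_of_set X)) y = real (card {x\<in>X. g x = y}) / card X"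
        using finX by (simp add: pmf_map measure_pmf_of_set Int_def vimage_def conj_commute)
      ultimately show ?thesis using K0 by (simp add: x_def)
    qed
    \<comment> \<open>Inserting the bound \<open>pg\<close> makes each fidelity term a fixed
      multiple of \<open>pmf Q y\<close>, so the sum collapses to that multiple of
      \<open>q\<close>.\<close>
    have "sqrt ((1 - 1 / \<Gamma>) * q) = (\<Sum>y\<in>A. sqrt ((1 - 1 / \<Gamma>) / q) * pmf Q y)"
    proof -
      have "sqrt ((1 - 1 / \<Gamma>) / q) * q = sqrt ((1 - 1 / \<Gamma>) * q)"
        using q0 real_div_sqrt[of q]
        by (simp add: real_sqrt_divide real_sqrt_mult flip: times_divide_eq_right)
      then show ?thesis by (simp add: qsum flip: sum_distrib_left)
    qed
    also have "\<dots> \<le> (\<Sum>y\<in>A. sqrt (pmf (map_pmf g (pmf_of_set X)) y) * sqrt (pmf Q y))"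
    proof (rule sum_mono)
      fix y assume y: "y \<in> A"
      have "sqrt ((1 - 1 / \<Gamma>) / q) * pmf Q y = sqrt ((1 - 1 / \<Gamma>) * (pmf Q y / q)) * sqrt (pmf Q y)"
        by (simp add: real_sqrt_divide real_sqrt_mult)
      also have "\<dots> \<le> sqrt (pmf (map_pmf g (pmf_of_set X)) y) * sqrt (pmf Q y)"
        using pg[OF y] by (intro mult_right_mono) auto
      finally show "sqrt ((1 - 1 / \<Gamma>) / q) * pmf Q y \<le> \<dots>" .
    qed
    also have "\<dots> \<le> fidelity Y (map_pmf g (pmf_of_set X)) Q"
      unfolding fidelity_def using finY AY by (intro sum_mono2) auto
    also have "\<dots> \<le> fidelity_D X (pmf_of_set X) Y Q N"
      unfolding fidelity_D_def by (rule cSup_upper[OF inD bdd])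
    finally show ?thesis by (simp add: q_def A_def)
  qed
qed

section \<open>The central limit theorem for words\<close>

lemma replicate_pmf_Suc_conv_pair:
  "replicate_pmf (Suc n) Q = map_pmf (\<lambda>(y, ys). y # ys) (pair_pmf Q (replicate_pmf n Q))"
  by (simp add: pair_pmf_def map_bind_pmf bind_return_pmf map_return_pmf)

text \<open>Fubini for the first letter, reduced to finite sums; complex values are needed for
  characteristic functions.\<close>

lemma integral_replicate_pmf_Suc:
  fixes F :: "'b list \<Rightarrow> complex"
  assumes fin: "finite (set_pmf Q)"
  shows "(LINT ys|measure_pmf (replicate_pmf (Suc n) Q). F ys) =
    (LINT y|measure_pmf Q. LINT ys|measure_pmf (replicate_pmf n Q). F (y # ys))"
proof -
  let ?R = "replicate_pmf n Q"
  have fR: "finite (set_pmf ?R)"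
    unfolding set_replicate_pmf using finite_lists_length_eq[OF fin] by (simp add: lists_eq_set)
  have "(LINT ys|measure_pmf (replicate_pmf (Suc n) Q). F ys)
    = (\<Sum>z\<in>set_pmf Q \<times> set_pmf ?R. pmf (pair_pmf Q ?R) z *\<^sub>R F (case z of (y, ys) \<Rightarrow> y # ys))"
    unfolding replicate_pmf_Suc_conv_pair integral_map_pmf
    by (rule integral_measure_pmf) (use fin fR in auto)
  also have "\<dots> = (\<Sum>y\<in>set_pmf Q. pmf Q y *\<^sub>R (\<Sum>ys\<in>set_pmf ?R. pmf ?R ys *\<^sub>R F (y # ys)))"
    by (simp add: scaleR_sum_right sum.cartesian_product) (rule sum.cong, auto simp: pmf_pair)
  also have "\<dots> = (LINT y|measure_pmf Q. LINT ys|measure_pmf ?R. F (y # ys))"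
    by (simp add: integral_measure_pmf[OF fin] integral_measure_pmf[OF fR])
  finally show ?thesis .
qed

text \<open>The exponential of a sum splits into a product, and independent letters contribute one
  factor each.\<close>

lemma char_distr_sum_list_replicate_pmf:
  assumes fin: "finite (set_pmf Q)"
  shows "char (distr (measure_pmf (replicate_pmf n Q)) borel (\<lambda>ys. \<Sum>y\<leftarrow>ys. f y)) t =
    char (distr (measure_pmf Q) borel f) t ^ n"
proof (induction n)
  case 0
  then show ?case by (simp add: char_def integral_distr)
next
  case (Suc n)
  have "char (distr (measure_pmf (replicate_pmf (Suc n) Q)) borel (\<lambda>ys. \<Sum>y\<leftarrow>ys. f y)) t
    = (LINT y|measure_pmf Q. LINT ys|measure_pmf (replicate_pmf n Q).
        iexp (t * f y) * iexp (t * (\<Sum>y\<leftarrow>ys. f y)))"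
    unfolding char_def
    by (subst integral_distr) (simp_all add: integral_replicate_pmf_Suc[OF fin] ring_distribs exp_add del: replicate_pmf.simps)
  also have "\<dots> = char (distr (measure_pmf Q) borel f) t
      * char (distr (measure_pmf (replicate_pmf n Q)) borel (\<lambda>ys. \<Sum>y\<leftarrow>ys. f y)) t"
    unfolding char_def by (simp add: integral_distr)
  finally show ?case using Suc by simp
qed

text \<open>The general theorem concerns a sequence of variables on one space. It is applied to the
  coordinates of an infinite product of copies of the law of \<open>g\<close>, then carried over to
  words of each length by comparing characteristic functions.\<close>

lemma central_limit_theorem_replicate_pmf:
  fixes g :: "'b \<Rightarrow> real"
  assumes fin: "finite (set_pmf Q)"
    and mean: "measure_pmf.expectation Q g = m"
    and var: "measure_pmf.variance Q g = v" and v: "v > 0"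
  shows "(\<lambda>n. measure_pmf.prob (replicate_pmf n Q) {ys. (\<Sum>y\<leftarrow>ys. g y - m) / sqrt (real n * v) \<le> x})
    \<longlonglongrightarrow> std_normal_cdf x"
proof -
  define \<mu> where "\<mu> = distr (measure_pmf Q) borel g"
  interpret \<mu>: prob_space \<mu>
    unfolding \<mu>_def by (rule measure_pmf.prob_space_distr) simp
  have [measurable_cong]: "sets \<mu> = sets borel" by (simp add: \<mu>_def)
  interpret P: product_prob_space "\<lambda>_::nat. \<mu>" UNIV ..
  let ?M = "PiM (UNIV :: nat set) (\<lambda>_. \<mu>)"
  have comp: "distr ?M borel (\<lambda>\<omega>. \<omega> i) = \<mu>" for i
  proof -
    have "distr ?M borel (\<lambda>\<omega>. \<omega> i) = distr ?M \<mu> (\<lambda>\<omega>. \<omega> i)"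
      by (rule distr_cong) (simp_all add: \<mu>_def)
    then show ?thesis using P.PiM_component[of i] by simp
  qed
  have rv [measurable]: "(\<lambda>\<omega>. \<omega> i) \<in> borel_measurable ?M" for i
    using measurable_component_singleton[of i UNIV "\<lambda>_. \<mu>"] by (simp add: \<mu>_def cong: measurable_cong_sets)
  have indep: "P.P.indep_vars (\<lambda>_. borel) (\<lambda>i \<omega>. \<omega> i) UNIV"
  proof (subst P.P.indep_vars_iff_distr_eq_PiM)
    have "distr ?M (PiM UNIV (\<lambda>_. borel)) (\<lambda>x. \<lambda>i\<in>UNIV. x i) = distr ?M ?M (\<lambda>x. x)"
      by (rule distr_cong) (auto simp: \<mu>_def intro!: sets_PiM_cong)
    then show "distr ?M (PiM UNIV (\<lambda>_. borel)) (\<lambda>x. \<lambda>i\<in>UNIV. x i) = PiM UNIV (\<lambda>i. distr ?M borel (\<lambda>\<omega>. \<omega> i))"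
      by (simp add: comp)
  qed auto
  have trans: "P.P.expectation (\<lambda>\<omega>. F (\<omega> i)) = measure_pmf.expectation Q (\<lambda>y. F (g y))"
    if [measurable]: "F \<in> borel_measurable borel" for F :: "real \<Rightarrow> real" and i
  proof -
    have "P.P.expectation (\<lambda>\<omega>. F (\<omega> i)) = integral\<^sup>L (distr ?M borel (\<lambda>\<omega>. \<omega> i)) F"
      by (subst integral_distr) auto
    also have "\<dots> = measure_pmf.expectation Q (\<lambda>y. F (g y))"
      unfolding comp unfolding \<mu>_def by (subst integral_distr) auto
    finally show ?thesis .
  qed
  have sqint: "integrable ?M (\<lambda>\<omega>. (\<omega> i)\<^sup>2)" for i
  proof -
    have "integrable (measure_pmf Q) (\<lambda>y. (g y)\<^sup>2)"
      using fin by (rule integrable_measure_pmf_finite)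
    then have "integrable \<mu> (\<lambda>x. x\<^sup>2)"
      unfolding \<mu>_def by (subst integrable_distr_eq) auto
    then show ?thesis
      by (subst (asm) comp[of i, symmetric], subst (asm) integrable_distr_eq) auto
  qed
  have clt: "weak_conv_m (\<lambda>n. distr ?M borel (\<lambda>\<omega>. (\<Sum>i<n. \<omega> i - m) / sqrt (real n * (sqrt v)\<^sup>2))) std_normal_distribution"
  proof (rule P.P.central_limit_theorem[OF indep])
    fix n
    show "P.P.expectation (\<lambda>\<omega>. \<omega> n) = m" using trans[of "\<lambda>x. x" n] mean by simp
    then show "P.P.variance (\<lambda>\<omega>. \<omega> n) = (sqrt v)\<^sup>2"
      using trans[of "\<lambda>x. (x - m)\<^sup>2" n] var v mean by simp
  qed (use v sqint comp in auto)
  \<comment> \<open>Both sides have as characteristic function that of one normalized letter raised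
    to the power \<open>n\<close>.\<close>
  have law: "distr ?M borel (\<lambda>\<omega>. (\<Sum>i<n. \<omega> i - m) / sqrt (real n * (sqrt v)\<^sup>2))
    = distr (measure_pmf (replicate_pmf n Q)) borel (\<lambda>ys. (\<Sum>y\<leftarrow>ys. g y - m) / sqrt (real n * v))"
    (is "?A = ?B") for n
  proof (rule Levy_uniqueness)
    let ?c = "sqrt (real n * v)"
    show "real_distribution ?A" by (rule P.P.real_distribution_distr) measurable
    show "real_distribution ?B" by (rule prob_space.real_distribution_distr[OF prob_space_measure_pmf]) simp
    show "char ?A = char ?B"
    proof
      fix t
      have ind: "P.P.indep_vars (\<lambda>_. borel) (\<lambda>i \<omega>. (\<omega> i - m) / ?c) {..<n}"
        by (rule P.P.indep_vars_subset[OF P.P.indep_vars_compose2[OF indep]]) auto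
      have "char ?A t = char (distr ?M borel (\<lambda>\<omega>. \<Sum>i<n. (\<omega> i - m) / ?c)) t"
        using v by (simp add: sum_divide_distrib)
      also have "\<dots> = (\<Prod>i<n. char (distr ?M borel (\<lambda>\<omega>. (\<omega> i - m) / ?c)) t)"
        by (rule P.P.char_distr_sum[OF ind])
      also have "\<dots> = char (distr (measure_pmf Q) borel (\<lambda>y. (g y - m) / ?c)) t ^ n"
      proof -
        have "distr ?M borel (\<lambda>\<omega>. (\<omega> i - m) / ?c) = distr (distr ?M borel (\<lambda>\<omega>. \<omega> i)) borel (\<lambda>x. (x - m) / ?c)" for i
          by (subst distr_distr) (auto simp: comp_def)
        also have "\<dots> i = distr (measure_pmf Q) borel (\<lambda>y. (g y - m) / ?c)" for i
          unfolding comp unfolding \<mu>_def by (subst distr_distr) (auto simp: comp_def)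
        finally show ?thesis by simp
      qed
      also have "\<dots> = char (distr (measure_pmf (replicate_pmf n Q)) borel (\<lambda>ys. \<Sum>y\<leftarrow>ys. (g y - m) / ?c)) t"
        by (rule char_distr_sum_list_replicate_pmf[OF fin, symmetric])
      also have "(\<lambda>ys. \<Sum>y\<leftarrow>ys. (g y - m) / ?c) = (\<lambda>ys. (\<Sum>y\<leftarrow>ys. g y - m) / ?c)"
      proof
        fix ys show "(\<Sum>y\<leftarrow>ys. (g y - m) / ?c) = (\<Sum>y\<leftarrow>ys. g y - m) / ?c"
          by (induction ys) (simp_all add: add_divide_distrib)
      qed
      finally show "char ?A t = char ?B t" .
    qed
  qed
  interpret N: real_distribution std_normal_distribution by (rule real_dist_normal_dist)
  \<comment> \<open>Points are null sets of the normal law, so its distribution function has no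
    jumps.\<close>
  have "isCont (cdf std_normal_distribution) x"
    unfolding N.isCont_cdf
    by (simp add: measure_def emeasure_density nn_integral_count_space_indicator)
  with clt have "(\<lambda>n. cdf (distr (measure_pmf (replicate_pmf n Q)) borel
      (\<lambda>ys. (\<Sum>y\<leftarrow>ys. g y - m) / sqrt (real n * v))) x) \<longlonglongrightarrow> std_normal_cdf x"
    unfolding law weak_conv_m_def weak_conv_def by simp
  then show ?thesis
    by (simp add: cdf_def measure_distr vimage_def)
qed

section \<open>The Gaussian limit of the \<open>Z\<close>-distance\<close>

interpretation std_normal: real_distribution std_normal_distribution
  by (rule real_dist_normal_dist)

section \<open>Calculus of the normal distribution function\<close>

lemma continuous_on_normal_density: "continuous_on S (normal_density \<mu> \<sigma>)"
proof (cases "\<sigma> = 0")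
  case True
  then show ?thesis by (simp add: normal_density_def)
next
  case False
  then show ?thesis unfolding normal_density_def by (intro continuous_intros) auto
qed

text \<open>Increments of the distribution function are integrals of the density, so the fundamental
  theorem of calculus applies. The base point \<open>x - 1\<close> keeps \<open>x\<close> inside the
  window.\<close>

lemma std_normal_cdf_has_real_derivative:
  "(std_normal_cdf has_real_derivative std_normal_density x) (at x)"
proof -
  let ?f = std_normal_density
  have eq: "std_normal_cdf u = std_normal_cdf (x - 1) + (LBINT y=ereal (x - 1)..ereal u. ?f y)" if "x - 1 < u" for u
  proof -
    have "std_normal_cdf u - std_normal_cdf (x - 1) = measure std_normal_distribution {x - 1<..u}"
      by (rule std_normal.cdf_diff_eq[OF that])
    also have "\<dots> = (LINT y|std_normal_distribution. indicator {x - 1<..u} y)"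
      by simp
    also have "\<dots> = (LINT y|lborel. ?f y * indicator {x - 1<..u} y)"
      by (subst integral_real_density) auto
    also have "\<dots> = (LBINT y=ereal (x - 1)..ereal u. ?f y)"
      using that by (subst interval_integral_Ioc) (auto simp: set_lebesgue_integral_def mult.commute)
    finally show ?thesis by simp
  qed
  have "((\<lambda>u. LBINT y=ereal (x - 1)..ereal u. ?f y) has_vector_derivative ?f x) (at x within {x - 1..x + 1})"
    by (rule interval_integral_FTC2) (auto intro: continuous_on_normal_density)
  then have "((\<lambda>u. LBINT y=ereal (x - 1)..ereal u. ?f y) has_real_derivative ?f x) (at x)"
    by (subst (asm) at_within_interior) (auto simp: has_real_derivative_iff_has_vector_derivative)
  then have "((\<lambda>u. std_normal_cdf (x - 1) + (LBINT y=ereal (x - 1)..ereal u. ?f y)) has_real_derivative ?f x) (at x)"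
    by (auto intro!: derivative_eq_intros)
  moreover have "\<forall>\<^sub>F u in nhds x. x - 1 < u"
    by (rule order_tendstoD(1)[OF filterlim_ident]) simp
  then have "\<forall>\<^sub>F u in nhds x. std_normal_cdf (x - 1) + (LBINT y=ereal (x - 1)..ereal u. ?f y) = std_normal_cdf u"
    by (rule eventually_mono) (simp add: eq)
  ultimately show ?thesis
    by (rule DERIV_cong_ev[OF refl _ refl, THEN iffD1, rotated])
qed

lemma isCont_std_normal_cdf: "isCont std_normal_cdf x"
  using std_normal_cdf_has_real_derivative by (rule DERIV_isCont)

lemma std_normal_cdf_pos: "0 < std_normal_cdf x"
proof -
  have "std_normal_cdf (x - 1) < std_normal_cdf x"
    by (rule DERIV_pos_imp_increasing) (auto intro!: exI std_normal_cdf_has_real_derivative normal_density_pos)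
  then show ?thesis
    using std_normal.cdf_nonneg[of "x - 1"] by linarith
qed

lemma normal_cdf_has_real_derivative:
  assumes "\<sigma> > 0"
  shows "((\<lambda>x. std_normal_cdf ((x - \<mu>) / \<sigma>)) has_real_derivative normal_density \<mu> \<sigma> x) (at x)"
proof -
  have "((\<lambda>x. std_normal_cdf ((x - \<mu>) / \<sigma>)) has_real_derivative
      std_normal_density ((x - \<mu>) / \<sigma>) * (1 / \<sigma>)) (at x)"
    by (rule DERIV_chain2[OF std_normal_cdf_has_real_derivative])
       (use assms in \<open>auto intro!: derivative_eq_intros\<close>)
  also have "std_normal_density ((x - \<mu>) / \<sigma>) * (1 / \<sigma>) = normal_density \<mu> \<sigma> x"
    using assms by (simp add: normal_density_def real_sqrt_mult power_divide)
  finally show ?thesis .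
qed

lemma normal_cdf_at_bot:
  assumes "\<sigma> > 0"
  shows "((\<lambda>x. std_normal_cdf ((x - \<mu>) / \<sigma>)) \<longlongrightarrow> 0) at_bot"
proof (rule filterlim_compose[OF std_normal.cdf_lim_at_bot])
  show "filterlim (\<lambda>x. (x - \<mu>) / \<sigma>) at_bot at_bot"
    using assms by real_asymp
qed

lemma normal_cdf_at_top:
  assumes "\<sigma> > 0"
  shows "((\<lambda>x. std_normal_cdf ((x - \<mu>) / \<sigma>)) \<longlongrightarrow> 1) at_top"
proof (rule filterlim_compose[OF std_normal.cdf_lim_at_top_prob])
  show "filterlim (\<lambda>x. (x - \<mu>) / \<sigma>) at_top at_top"
    using assms by real_asymp
qed

text \<open>The fundamental theorem with possibly infinite ends, put into the indicator form of the
  integrals over half-lines and the whole line below. The sign of \<open>f\<close> yields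
  integrability.\<close>

lemma integral_einterval_FTC_nonneg:
  fixes f F :: "real \<Rightarrow> real" and a b :: ereal
  assumes "a < b" and "\<And>x. (F has_real_derivative f x) (at x)" "\<And>x. isCont f x" "\<And>x. 0 \<le> f x"
    and "((F \<circ> real_of_ereal) \<longlongrightarrow> A) (at_right a)" "((F \<circ> real_of_ereal) \<longlongrightarrow> B) (at_left b)"
  shows "integrable lborel (\<lambda>x. indicator (einterval a b) x * f x)"
    and "(LINT x|lborel. indicator (einterval a b) x * f x) = B - A"
proof -
  note ftc = interval_integral_FTC_nonneg[of a b F f A B]
  show "integrable lborel (\<lambda>x. indicator (einterval a b) x * f x)"
    using ftc(1) assms by (simp add: set_integrable_def)
  show "(LINT x|lborel. indicator (einterval a b) x * f x) = B - A"
    using ftc(2) assms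
    by (simp add: interval_lebesgue_integral_def set_lebesgue_integral_def less_imp_le)
qed

lemma mono_imp_deriv_nonneg:
  fixes A :: "real \<Rightarrow> real"
  assumes "mono A" "(A has_real_derivative D) (at x)"
  shows "D \<ge> 0"
proof (rule ccontr)
  assume "\<not> D \<ge> 0"
  then obtain d where d: "d > 0" "\<And>h. 0 < h \<Longrightarrow> h < d \<Longrightarrow> A (x + h) < A x"
    using DERIV_neg_dec_right[OF assms(2)] by auto
  from d(2)[of "d / 2"] d(1) have "A (x + d / 2) < A x" by simp
  then show False using monoD[OF assms(1), of x "x + d / 2"] d(1) by simp
qed

text \<open>The bound \<Phi> \<le> A does not force an admissible curve down to 0 at minus infinity,
  so its limit there is only known as the infimum of its values.\<close>

lemma mono_tendsto_Inf_at_bot: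
  fixes A :: "real \<Rightarrow> real"
  assumes "mono A" "bdd_below (range A)"
  shows "(A \<longlongrightarrow> Inf (range A)) at_bot"
proof (rule decreasing_tendsto)
  show "\<forall>\<^sub>F x in at_bot. Inf (range A) \<le> A x"
    using assms by (simp add: cInf_lower)
  fix y assume "Inf (range A) < y"
  then obtain x0 where "A x0 < y" using assms(2) by (auto simp: cInf_less_iff)
  then have "A x < y" if "x \<le> x0" for x using monoD[OF assms(1) that] by linarith
  then show "\<forall>\<^sub>F x in at_bot. A x < y" by (auto simp: eventually_at_bot_linorder)
qed

lemma AM_GM_weighted:
  fixes a b c :: real
  assumes "a \<ge> 0" "b \<ge> 0" "c > 0"
  shows "sqrt (a * b) \<le> (c * a + b / c) / 2"
  using arith_geo_mean_sqrt[of "c * a" "b / c"] assms by simp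

section \<open>Fidelity between admissible curves and normal densities\<close>

lemma density_fidelity_nonneg:
  assumes "\<And>x. p x \<ge> 0" "\<And>x. q x \<ge> 0"
  shows "density_fidelity p q \<ge> 0"
  unfolding density_fidelity_def by (intro Bochner_Integration.integral_nonneg) (simp add: assms)

text \<open>The continuous derivative supplied by the C1 condition is identified with
  \<open>deriv\<close>, which is what \<open>Z_dist\<close> refers to.\<close>

lemma admissible_cdfs_deriv:
  assumes A: "A \<in> admissible_cdfs s"
  shows "(A has_real_derivative deriv A x) (at x)" "isCont (deriv A) x" "deriv A x \<ge> 0"
proof -
  obtain D where D: "\<And>x. (A has_vector_derivative D x) (at x)" "continuous_on UNIV D"
    using A by (auto simp: admissible_cdfs_def C1_differentiable_on_def)
  then have "(A has_real_derivative D x) (at x)" for x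
    by (simp add: has_real_derivative_iff_has_vector_derivative)
  then have eq: "deriv A = D" by (auto intro: DERIV_imp_deriv)
  show 1: "(A has_real_derivative deriv A x) (at x)" unfolding eq by fact
  show "isCont (deriv A) x" unfolding eq using D(2) by (simp add: continuous_on_eq_continuous_at)
  show "deriv A x \<ge> 0" using A 1 by (auto simp: admissible_cdfs_def intro: mono_imp_deriv_nonneg)
qed

text \<open>Splitting the line at \<open>b\<close> and applying the inequality of arithmetic and geometric means with
  a free weight on either side avoids the Cauchy--Schwarz inequality for integrals.\<close>

lemma density_fidelity_admissible_le:
  assumes A: "A \<in> admissible_cdfs s" and \<sigma>: "\<sigma> > 0" and c: "c > 0" and d: "d > 0"
  shows "density_fidelity (deriv A) (normal_density \<mu> \<sigma>)
    \<le> (c + std_normal_cdf ((b - \<mu>) / \<sigma>) / c) / 2 + (d * (1 - A b) + 1 / d) / 2"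
proof -
  let ?\<phi> = "normal_density \<mu> \<sigma>" and ?G = "\<lambda>x. std_normal_cdf ((x - \<mu>) / \<sigma>)"
  let ?l = "\<lambda>x::real. indicator {..<b} x :: real" and ?r = "\<lambda>x::real. indicator {b<..} x :: real"
  define La where "La = Inf (range A)"
  note dA = admissible_cdfs_deriv[OF A]
  have mono: "mono A" and rng: "\<And>x. 0 \<le> A x" "\<And>x. A x \<le> 1" and As: "A s = 1"
    using A unfolding admissible_cdfs_def image_subset_iff by auto
  have bb: "bdd_below (range A)" using rng by (auto intro: bdd_belowI[of _ 0])
  have La: "(A \<longlongrightarrow> La) at_bot" unfolding La_def by (rule mono_tendsto_Inf_at_bot[OF mono bb])
  have La0: "La \<ge> 0" unfolding La_def using rng by (intro cInf_greatest) auto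
  have Ar: "(A \<longlongrightarrow> 1) at_top"
  proof (rule tendsto_eventually)
    have "A x = 1" if "x \<ge> s" for x using monoD[OF mono that] As rng(2)[of x] by simp
    then show "\<forall>\<^sub>F x in at_top. A x = 1" by (auto simp: eventually_at_top_linorder)
  qed
  have lim: "(F \<longlongrightarrow> F b) (at_left b)" "(F \<longlongrightarrow> F b) (at_right b)" if "\<And>x. (F has_real_derivative f x) (at x)"
    for F f :: "real \<Rightarrow> real"
    using DERIV_isCont[OF that[of b]] unfolding isCont_def by (auto intro: tendsto_mono at_le)
  have D: "integrable lborel (\<lambda>x. ?l x * deriv A x)" "(LINT x|lborel. ?l x * deriv A x) = A b - La"
    using integral_einterval_FTC_nonneg[of "-\<infinity>" "ereal b" A "deriv A" La "A b"] dA La lim[OF dA(1)]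
    by (simp_all add: ereal_tendsto_simps1)
  have D': "integrable lborel (\<lambda>x. ?r x * deriv A x)" "(LINT x|lborel. ?r x * deriv A x) = 1 - A b"
    using integral_einterval_FTC_nonneg[of "ereal b" "\<infinity>" A "deriv A" "A b" 1] dA Ar lim[OF dA(1)]
    by (simp_all add: ereal_tendsto_simps1)
  note dG = normal_cdf_has_real_derivative[OF \<sigma>, of \<mu>]
  have cont: "isCont ?\<phi> x" for x
    using continuous_on_normal_density[of UNIV \<mu> \<sigma>] by (simp add: continuous_on_eq_continuous_at)
  have N: "integrable lborel (\<lambda>x. ?l x * ?\<phi> x)" "(LINT x|lborel. ?l x * ?\<phi> x) = ?G b"
    using integral_einterval_FTC_nonneg[of "-\<infinity>" "ereal b" ?G ?\<phi> 0 "?G b"] dG cont lim[OF dG] normal_cdf_at_bot[OF \<sigma>]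
    by (simp_all add: ereal_tendsto_simps1)
  have N': "integrable lborel (\<lambda>x. ?r x * ?\<phi> x)" "(LINT x|lborel. ?r x * ?\<phi> x) = 1 - ?G b"
    using integral_einterval_FTC_nonneg[of "ereal b" "\<infinity>" ?G ?\<phi> "?G b" 1] dG cont lim[OF dG] normal_cdf_at_top[OF \<sigma>]
    by (simp_all add: ereal_tendsto_simps1)
  let ?h = "\<lambda>x. (c / 2) * (?l x * deriv A x) + (1 / (2 * c)) * (?l x * ?\<phi> x)
     + (d / 2) * (?r x * deriv A x) + (1 / (2 * d)) * (?r x * ?\<phi> x)"
  have "density_fidelity (deriv A) ?\<phi> \<le> (LINT x|lborel. ?h x)"
    unfolding density_fidelity_def
  proof (rule integral_mono_AE')
    show "integrable lborel ?h" using D(1) D'(1) N(1) N'(1) by simp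
    \<comment> \<open>The two open half-lines miss only the point \<open>b\<close>, a null
      set.\<close>
    show "AE x in lborel. sqrt (deriv A x * ?\<phi> x) \<le> ?h x"
      using AE_lborel_singleton[of b]
    proof eventually_elim
      case (elim x)
      have "sqrt (deriv A x * ?\<phi> x) \<le> (c * deriv A x + ?\<phi> x / c) / 2"
        "sqrt (deriv A x * ?\<phi> x) \<le> (d * deriv A x + ?\<phi> x / d) / 2"
        using c d dA(3) by (simp_all only: AM_GM_weighted normal_density_nonneg)
      then show ?case using elim by (cases "x < b") (auto simp: indicator_def add_divide_distrib)
    qed
    show "AE x in lborel. 0 \<le> ?h x"
      using c d dA(3) by simp
  qed
  also have "\<dots> = (c / 2) * (A b - La) + (1 / (2 * c)) * ?G b + (d / 2) * (1 - A b) + (1 / (2 * d)) * (1 - ?G b)"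
    using D N D' N' by (simp del: mult_divide_mult_cancel_left times_divide_eq_left)
  \<comment> \<open>The mass of the curve on the left and the Gaussian mass on the right are bounded
    by 1; the two quantities that the estimate keeps are the Gaussian mass on the left and the mass
    of the curve on the right.\<close>
  also have "\<dots> \<le> (c / 2) * 1 + (1 / (2 * c)) * ?G b + (d / 2) * (1 - A b) + (1 / (2 * d)) * 1"
    using c d La0 rng(2)[of b] std_normal.cdf_nonneg by (intro add_mono mult_left_mono) auto
  finally show ?thesis by (simp add: add_divide_distrib)
qed

text \<open>Away from 0 this is the power rule or a constant. At 0 the difference quotient is at
  most \<open>\<bar>h\<bar> powr (k - 1)\<close> in absolute value, which vanishes since k >
  1.\<close>

lemma max_0_powr_has_real_derivative:
  fixes z :: real
  assumes k: "k > 1"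
  shows "((\<lambda>z. max 0 z powr k) has_real_derivative k * max 0 z powr (k - 1)) (at z)"
proof (cases z "0 :: real" rule: linorder_cases)
  case less
  have "((\<lambda>z. 0) has_real_derivative k * max 0 z powr (k - 1)) (at z)" using less by simp
  moreover have "\<forall>\<^sub>F u in nhds z. u < 0"
    using less by (rule order_tendstoD(2)[OF filterlim_ident])
  then have "\<forall>\<^sub>F u in nhds z. 0 = max 0 u powr k" by eventually_elim auto
  ultimately show ?thesis
    by (rule DERIV_cong_ev[OF refl _ refl, THEN iffD1, rotated])
next
  case greater
  have "((\<lambda>z. z powr k) has_real_derivative k * max 0 z powr (k - 1)) (at z)"
    using greater by (auto intro!: derivative_eq_intros)
  moreover have "\<forall>\<^sub>F u in nhds z. 0 < u"
    using greater by (rule order_tendstoD(1)[OF filterlim_ident])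
  then have "\<forall>\<^sub>F u in nhds z. u powr k = max 0 u powr k" by eventually_elim auto
  ultimately show ?thesis
    by (rule DERIV_cong_ev[OF refl _ refl, THEN iffD1, rotated])
next
  case equal
  have "((\<lambda>h. max 0 h powr k / h) \<longlongrightarrow> 0) (at 0)"
  proof (rule Lim_null_comparison)
    show "\<forall>\<^sub>F h in at 0. norm (max 0 h powr k / h) \<le> \<bar>h\<bar> powr (k - 1)"
    proof (rule always_eventually, rule allI)
      fix h :: real
      show "norm (max 0 h powr k / h) \<le> \<bar>h\<bar> powr (k - 1)"
      proof (cases "h > 0")
        case True
        then show ?thesis by (simp add: powr_diff)
      qed (simp add: max_def)
    qed
    show "((\<lambda>h::real. \<bar>h\<bar> powr (k - 1)) \<longlongrightarrow> 0) (at 0)"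
      using k by (auto intro!: tendsto_eq_intros)
  qed
  then show ?thesis unfolding has_field_derivative_def[symmetric] DERIV_def using equal by simp
qed

lemma one_minus_Z_dist_le:
  assumes ne: "admissible_cdfs s \<noteq> {}" and v: "v > 0"
    and le: "\<And>A. A \<in> admissible_cdfs s \<Longrightarrow> density_fidelity (deriv A) (normal_density \<mu> (sqrt v)) \<le> B"
  shows "1 - Z_dist v s \<mu> \<le> B\<^sup>2"
proof -
  have "(SUP A\<in>admissible_cdfs s. (density_fidelity (deriv A) (normal_density \<mu> (sqrt v)))\<^sup>2) \<le> B\<^sup>2"
    using le by (intro cSUP_least[OF ne] power_mono density_fidelity_nonneg admissible_cdfs_deriv(3)) auto
  then show ?thesis by (simp add: Z_dist_def)
qed

text \<open>A real supremum dominates its members once they are bounded. The bound 2 on the fidelity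
  comes from \<open>density_fidelity_admissible_le\<close> with both weights 1 and split point
  0.\<close>

lemma one_minus_Z_dist_ge:
  assumes A: "A \<in> admissible_cdfs s" and v: "v > 0"
  shows "(density_fidelity (deriv A) (normal_density \<mu> (sqrt v)))\<^sup>2 \<le> 1 - Z_dist v s \<mu>"
proof -
  have "density_fidelity (deriv A) (normal_density \<mu> (sqrt v)) \<le> 2" if A: "A \<in> admissible_cdfs s" for A
  proof -
    have "density_fidelity (deriv A) (normal_density \<mu> (sqrt v))
        \<le> (1 + std_normal_cdf ((0 - \<mu>) / sqrt v) / 1) / 2 + (1 * (1 - A 0) + 1 / 1) / 2"
      using v by (intro density_fidelity_admissible_le[OF A]) auto
    moreover have "0 \<le> A 0" using A unfolding admissible_cdfs_def image_subset_iff by auto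
    moreover note std_normal.cdf_bounded_prob[of "(0 - \<mu>) / sqrt v"]
    ultimately show ?thesis by argo
  qed
  then have "bdd_above ((\<lambda>A. (density_fidelity (deriv A) (normal_density \<mu> (sqrt v)))\<^sup>2) ` admissible_cdfs s)"
    by (intro bdd_aboveI2[of _ _ "2\<^sup>2"] power_mono density_fidelity_nonneg admissible_cdfs_deriv(3)) auto
  from cSUP_upper[OF A this] show ?thesis by (simp add: Z_dist_def)
qed

text \<open>The optimal curve is the cumulative distribution function of the normal distribution
  conditioned on \<open>{..b}\<close>, which has a kink at \<open>b\<close>.  Replacing the argument \<open>y\<close> by
  \<open>1 - (1 - y) powr (1 + 2 * a)\<close> removes the kink at the price of a factor tending to 1 as \<open>a\<close>
  tends to 0, and keeps the fidelity integral elementary.\<close>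

lemma exists_admissible_cdf_fidelity:
  assumes \<kappa>: "\<kappa> > 1" and a: "a > 0" and bs: "b < s" and b\<mu>: "b * (\<kappa> - 1) \<le> - \<mu>"
  shows "\<exists>A\<in>admissible_cdfs s. (density_fidelity (deriv A) (normal_density \<mu> \<kappa>))\<^sup>2
    = std_normal_cdf ((b - \<mu>) / \<kappa>) * (1 + 2 * a) / (1 + a)\<^sup>2"
proof -
  define G where "G x = std_normal_cdf ((x - \<mu>) / \<kappa>)" for x
  define k where "k = 1 + 2 * a"
  \<comment> \<open>The normal law conditioned on \<open>{..b}\<close> has distribution function
    \<open>G x / G b\<close>, capped at 1; \<open>z\<close> is its complement.\<close>
  define z where "z x = max 0 (1 - G x / G b)" for x
  define A where "A x = 1 - z x powr k" for x
  let ?\<phi> = "normal_density \<mu> \<kappa>"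
  have \<kappa>0: "\<kappa> > 0" using \<kappa> by simp
  have G0: "G x > 0" for x by (simp add: G_def std_normal_cdf_pos)
  have G1: "G x \<le> 1" for x by (simp add: G_def std_normal.cdf_bounded_prob)
  have Gmono: "G x \<le> G y" if "x \<le> y" for x y
    unfolding G_def using that \<kappa>0 by (intro std_normal.cdf_nondecreasing divide_right_mono) auto
  have dG: "(G has_real_derivative ?\<phi> x) (at x)" for x
    unfolding G_def by (rule normal_cdf_has_real_derivative[OF \<kappa>0])
  have z: "0 \<le> z x" "z x \<le> 1" for x using G0[of x] G0[of b] by (auto simp: z_def)
  have z0: "z x = 0" if "b \<le> x" for x using Gmono[OF that] G0[of b] by (simp add: z_def)
  have zmono: "z y \<le> z x" if "x \<le> y" for x y
    using Gmono[OF that] G0[of b] unfolding z_def by (intro max.mono diff_mono divide_right_mono) auto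
  have dz: "((\<lambda>x. z x powr p) has_real_derivative - (p * z x powr (p - 1)) * ?\<phi> x / G b) (at x)"
    if "p > 1" for p x
  proof -
    have "((\<lambda>x. 1 - G x / G b) has_real_derivative - ?\<phi> x / G b) (at x)"
      using G0[of b] by (auto intro!: derivative_eq_intros dG)
    from DERIV_chain2[where f = "\<lambda>u. max 0 u powr p" and g = "\<lambda>x. 1 - G x / G b",
        OF max_0_powr_has_real_derivative[OF that] this]
    show ?thesis by (simp add: z_def)
  qed
  have k: "k > 1" using a by (simp add: k_def)
  define D where "D x = k * z x powr (2 * a) * ?\<phi> x / G b" for x
  have dA: "(A has_real_derivative D x) (at x)" for x
    unfolding A_def D_def using DERIV_diff[OF DERIV_const[of 1] dz[OF k, of x]] by (simp add: k_def)
  then have derivA: "deriv A = D" by (auto intro: DERIV_imp_deriv)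
  have contG: "continuous_on UNIV G" using dG by (intro DERIV_continuous_on) (auto intro: DERIV_subset)
  have contz: "continuous_on UNIV z"
    unfolding z_def by (intro continuous_intros contG) (use G0[of b] in auto)
  have contzp: "continuous_on UNIV (\<lambda>x. z x powr p)" if "p > 0" for p
    using that z(1) by (intro continuous_on_powr' contz continuous_on_const) auto
  have contD: "continuous_on UNIV D"
    unfolding D_def using a G0[of b]
    by (intro continuous_intros contzp continuous_on_normal_density) auto
  have A_adm: "A \<in> admissible_cdfs s"
    unfolding admissible_cdfs_def mem_Collect_eq
  proof (intro conjI allI)
    show "A C1_differentiable_on UNIV"
      unfolding C1_differentiable_on_def using dA contD
      by (auto simp: has_real_derivative_iff_has_vector_derivative)
    show "mono A"
      unfolding A_def using k by (intro monoI diff_left_mono powr_mono2 z zmono) auto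
    have Ar: "0 \<le> A x" "A x \<le> 1" for x
      unfolding A_def using k z[of x] powr_le1[of k "z x"] by auto
    then show "range A \<subseteq> {0..1}" "A x \<le> 1" for x by auto
    show "A s = 1" using z0[of s] bs by (simp add: A_def)
    \<comment> \<open>Left of \<open>b\<close> the hypothesis on \<open>b\<close> gives
      \<open>x \<le> (x - \<mu>) / \<kappa>\<close>, so \<Phi> lies below \<open>G\<close>; division
      by \<open>G b\<close> and the exponent \<open>k\<close> only raise the curve. Right of
      \<open>b\<close> the curve is 1.\<close>
    show "std_normal_cdf x \<le> A x" for x
    proof (cases "x \<le> b")
      case True
      have "x * (\<kappa> - 1) \<le> b * (\<kappa> - 1)" using True \<kappa> by (intro mult_right_mono) auto
      then have "x * \<kappa> \<le> x - \<mu>" using b\<mu> by (simp add: algebra_simps)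
      then have "x \<le> (x - \<mu>) / \<kappa>" using \<kappa>0 by (simp add: field_simps)
      then have "std_normal_cdf x \<le> G x" unfolding G_def by (rule std_normal.cdf_nondecreasing)
      also have "G x \<le> G x / G b" using G0[of x] G0[of b] G1[of b] by (simp add: field_simps)
      also have "G x / G b \<le> 1" using Gmono[OF True] G0[of b] by simp
      then have "G x / G b = 1 - z x" by (simp add: z_def)
      also have "\<dots> \<le> A x"
        unfolding A_def using z[of x] k powr_mono'[of 1 k "z x"] by simp
      finally show ?thesis .
    next
      case False
      then show ?thesis using z0[of x] by (simp add: A_def std_normal.cdf_bounded_prob)
    qed
  qed
  \<comment> \<open>As \<open>D\<close> is a power of \<open>z\<close> times the density, the
    fidelity integrand is again of this form, so a multiple of a power of \<open>z\<close> is an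
    antiderivative. The constant \<open>c\<close> is the resulting total integral.\<close>
  define c where "c = sqrt (k * G b) / (1 + a)"
  define R where "R x = - c * z x powr (1 + a)" for x
  define r where "r x = sqrt (D x * ?\<phi> x)" for x
  have sqrtD: "r x = sqrt (k / G b) * z x powr a * ?\<phi> x" for x
  proof -
    have "z x powr (2 * a) = (z x powr a)\<^sup>2"
      unfolding mult_2 power2_eq_square by (rule powr_add)
    then have "D x * ?\<phi> x = (k / G b) * (z x powr a * ?\<phi> x)\<^sup>2"
      by (simp add: D_def power2_eq_square)
    then show ?thesis unfolding r_def by (simp add: real_sqrt_mult real_sqrt_divide)
  qed
  have dR: "(R has_real_derivative r x) (at x)" for x
  proof -
    have "(R has_real_derivative - c * (- ((1 + a) * z x powr (1 + a - 1)) * ?\<phi> x / G b)) (at x)"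
      unfolding R_def using a by (intro DERIV_cmult dz) simp
    also have "- c * (- ((1 + a) * z x powr (1 + a - 1)) * ?\<phi> x / G b)
      = c * (1 + a) / G b * z x powr a * ?\<phi> x" by simp
    also have "c * (1 + a) / G b = sqrt (k / G b)"
    proof -
      have "c * (1 + a) = sqrt (k * G b)" using a by (simp add: c_def)
      moreover have "sqrt (k * G b) / G b = sqrt (k / G b)"
        using G0[of b] by (simp add: real_sqrt_mult real_sqrt_divide sqrt_divide_self_eq field_simps)
      ultimately show ?thesis by simp
    qed
    finally show ?thesis unfolding sqrtD .
  qed
  have contr: "isCont r x" for x
  proof -
    have "continuous_on UNIV r"
      unfolding sqrtD[abs_def] using a by (intro continuous_intros contzp continuous_on_normal_density) auto
    then show ?thesis by (simp add: continuous_on_eq_continuous_at)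
  qed
  have "(G \<longlongrightarrow> 0) at_bot" unfolding G_def[abs_def] by (rule normal_cdf_at_bot[OF \<kappa>0])
  then have "(z \<longlongrightarrow> max 0 (1 - 0 / G b)) at_bot"
    unfolding z_def[abs_def] using G0[of b] by (intro tendsto_intros) auto
  then have "(R \<longlongrightarrow> - c * 1 powr (1 + a)) at_bot"
    unfolding R_def[abs_def] by (intro tendsto_intros) auto
  then have Rbot: "(R \<longlongrightarrow> - c) at_bot" by simp
  have "R x = 0" if "b \<le> x" for x using z0[OF that] by (simp add: R_def)
  then have Rtop: "(R \<longlongrightarrow> 0) at_top"
    by (intro tendsto_eventually) (auto simp: eventually_at_top_linorder)
  have "r x \<ge> 0" for x unfolding sqrtD using k G0[of b] by simp
  then have "(LINT x|lborel. r x) = 0 - (- c)"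
    using integral_einterval_FTC_nonneg(2)[of "-\<infinity>" "\<infinity>" R r "- c" 0] dR contr Rbot Rtop
    by (simp add: ereal_tendsto_simps1)
  then have "density_fidelity (deriv A) ?\<phi> = c"
    by (simp add: density_fidelity_def derivA r_def)
  then have "(density_fidelity (deriv A) ?\<phi>)\<^sup>2 = G b * (1 + 2 * a) / (1 + a)\<^sup>2"
    using k G0[of b] by (simp add: c_def power_divide k_def mult.commute)
  then show ?thesis using A_adm unfolding G_def by blast
qed

text \<open>In units of \<open>1 / \<sigma>\<close>, the explicit curve with split point
  \<open>min s 0 - \<epsilon>\<close> gives the lower bound and the weighted estimate split at
  \<open>min s 0 + \<epsilon>\<close> the upper bound. Only after the limit along \<open>F\<close>
  does \<epsilon> tend to 0.\<close>

lemma one_minus_Z_dist_tendsto: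
  fixes \<sigma> \<tau> :: "'x \<Rightarrow> real"
  assumes \<sigma>: "filterlim \<sigma> (at_right 0) F" and \<tau>: "(\<tau> \<longlongrightarrow> c) F" and c: "c > 0"
  shows "((\<lambda>p. 1 - Z_dist ((\<tau> p / \<sigma> p)\<^sup>2) (s / \<sigma> p) (m / \<sigma> p)) \<longlongrightarrow> std_normal_cdf ((min s 0 - m) / c)) F"
proof -
  define S where "S p = 1 - Z_dist ((\<tau> p / \<sigma> p)\<^sup>2) (s / \<sigma> p) (m / \<sigma> p)" for p
  have \<sigma>0: "(\<sigma> \<longlongrightarrow> 0) F" and \<sigma>pos: "\<forall>\<^sub>F p in F. \<sigma> p > 0"
    using \<sigma> by (auto simp: filterlim_at elim: eventually_mono)
  have \<tau>pos: "\<forall>\<^sub>F p in F. \<tau> p > 0" using order_tendstoD(1)[OF \<tau> c] .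
  have tendsto_cdf: "((\<lambda>p. std_normal_cdf (f p)) \<longlongrightarrow> std_normal_cdf w) G'" if "(f \<longlongrightarrow> w) G'" for f w and G' :: "'y filter"
    using isCont_tendsto_compose[OF isCont_std_normal_cdf that] .
  \<comment> \<open>Existence of an admissible curve is recorded too, because the upper bound on the
    supremum needs a nonempty set.\<close>
  have lower: "\<forall>\<^sub>F p in F. (\<exists>A. A \<in> admissible_cdfs (s / \<sigma> p))
      \<and> std_normal_cdf ((min s 0 - \<epsilon> - m) / \<tau> p) * (1 + 2 * \<epsilon>) / (1 + \<epsilon>)\<^sup>2 \<le> S p" if \<epsilon>: "\<epsilon> > 0" for \<epsilon>
  proof -
    have "((\<lambda>p. \<tau> p - \<sigma> p) \<longlongrightarrow> c - 0) F" by (intro tendsto_intros \<tau> \<sigma>0)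
    then have e1: "\<forall>\<^sub>F p in F. \<tau> p - \<sigma> p > 0" by (rule order_tendstoD(1)) (use c in simp)
    \<comment> \<open>Up to the factor \<open>(\<sigma> p)\<^sup>2\<close>, this is the hypothesis
      on the split point in \<open>exists_admissible_cdf_fidelity\<close>; the limit is positive
      because \<open>\<epsilon> - min s 0\<close> and \<open>c\<close> are.\<close>
    have "((\<lambda>p. (\<epsilon> - min s 0) * (\<tau> p - \<sigma> p) - m * \<sigma> p) \<longlongrightarrow> (\<epsilon> - min s 0) * (c - 0) - m * 0) F"
      by (intro tendsto_intros \<tau> \<sigma>0)
    then have e2: "\<forall>\<^sub>F p in F. (\<epsilon> - min s 0) * (\<tau> p - \<sigma> p) - m * \<sigma> p > 0"
      by (rule order_tendstoD(1)) (use c \<epsilon> in \<open>auto intro!: mult_pos_pos\<close>)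
    show ?thesis using e1 e2 \<sigma>pos \<tau>pos
    proof eventually_elim
      case (elim p)
      define b where "b = (min s 0 - \<epsilon>) / \<sigma> p"
      have 1: "\<tau> p / \<sigma> p > 1" using elim by simp
      have 2: "b < s / \<sigma> p" unfolding b_def using elim \<epsilon> by (intro divide_strict_right_mono) auto
      have 3: "b * (\<tau> p / \<sigma> p - 1) \<le> - (m / \<sigma> p)"
      proof -
        have "b * (\<tau> p / \<sigma> p - 1) = ((min s 0 - \<epsilon>) * (\<tau> p - \<sigma> p) / \<sigma> p) / \<sigma> p"
          using elim by (simp add: b_def field_simps)
        also have "\<dots> \<le> - m / \<sigma> p"
          using elim by (intro divide_right_mono) (auto simp: field_simps)
        finally show ?thesis by simp
      qed
      obtain A where A: "A \<in> admissible_cdfs (s / \<sigma> p)"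
        "(density_fidelity (deriv A) (normal_density (m / \<sigma> p) (\<tau> p / \<sigma> p)))\<^sup>2
          = std_normal_cdf ((b - m / \<sigma> p) / (\<tau> p / \<sigma> p)) * (1 + 2 * \<epsilon>) / (1 + \<epsilon>)\<^sup>2"
        using exists_admissible_cdf_fidelity[OF 1 \<epsilon> 2 3] by blast
      have "(b - m / \<sigma> p) / (\<tau> p / \<sigma> p) = (min s 0 - \<epsilon> - m) / \<tau> p"
        using elim by (simp add: b_def field_simps)
      moreover have "sqrt ((\<tau> p / \<sigma> p)\<^sup>2) = \<tau> p / \<sigma> p" using elim by simp
      ultimately show ?case
        using one_minus_Z_dist_ge[OF A(1), of "(\<tau> p / \<sigma> p)\<^sup>2" "m / \<sigma> p"] A elim by (auto simp: S_def)
    qed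
  qed
  have upper: "\<exists>B. (B \<longlongrightarrow> (sqrt (std_normal_cdf ((min s 0 + \<epsilon> - m) / c)) + \<epsilon> / 2)\<^sup>2) F \<and> (\<forall>\<^sub>F p in F. S p \<le> B p)"
    if \<epsilon>: "\<epsilon> > 0" for \<epsilon>
  proof -
    \<comment> \<open>A bound for \<open>1 - A b\<close>. If \<open>s\<close> is nonpositive,
      \<open>b\<close> lies right of \<open>s / \<sigma> p\<close>, where the curve is already 1;
      otherwise \<Phi> \<le> A leaves only a Gaussian tail beyond
      \<open>\<epsilon> / \<sigma> p\<close>.\<close>
    define \<eta> where "\<eta> p = (if s \<le> 0 then 0 else 1 - std_normal_cdf (\<epsilon> / \<sigma> p))" for p
    define f where "f p = std_normal_cdf ((min s 0 + \<epsilon> - m) / \<tau> p)" for p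
    define B where "B p = (sqrt (f p) + (\<eta> p / \<epsilon> + \<epsilon>) / 2)\<^sup>2" for p
    have "filterlim (\<lambda>p. \<epsilon> * inverse (\<sigma> p)) at_top F"
      using \<epsilon> by (intro filterlim_tendsto_pos_mult_at_top[OF tendsto_const _ filterlim_compose[OF filterlim_inverse_at_top_right \<sigma>]])
    then have "((\<lambda>p. std_normal_cdf (\<epsilon> / \<sigma> p)) \<longlongrightarrow> 1) F"
      unfolding divide_inverse by (rule filterlim_compose[OF std_normal.cdf_lim_at_top_prob])
    then have "((\<lambda>p. 1 - std_normal_cdf (\<epsilon> / \<sigma> p)) \<longlongrightarrow> 1 - 1) F" by (intro tendsto_intros)
    then have \<eta>: "(\<eta> \<longlongrightarrow> 0) F" unfolding \<eta>_def[abs_def] by (cases "s \<le> 0") simp_all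
    have f: "(f \<longlongrightarrow> std_normal_cdf ((min s 0 + \<epsilon> - m) / c)) F"
      unfolding f_def[abs_def] using c by (intro tendsto_cdf tendsto_intros \<tau>) auto
    have "(B \<longlongrightarrow> (sqrt (std_normal_cdf ((min s 0 + \<epsilon> - m) / c)) + (0 / \<epsilon> + \<epsilon>) / 2)\<^sup>2) F"
      unfolding B_def[abs_def] using \<epsilon> by (intro tendsto_intros f \<eta>) auto
    moreover have "\<forall>\<^sub>F p in F. S p \<le> B p"
      using lower[OF \<epsilon>] \<sigma>pos \<tau>pos
    proof eventually_elim
      case (elim p)
      define b where "b = (min s 0 + \<epsilon>) / \<sigma> p"
      have eq: "(b - m / \<sigma> p) / (\<tau> p / \<sigma> p) = (min s 0 + \<epsilon> - m) / \<tau> p"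
        using elim by (simp add: b_def field_simps)
      have f0: "f p > 0" by (simp add: f_def std_normal_cdf_pos)
      show ?case unfolding S_def B_def
      proof (rule one_minus_Z_dist_le)
        fix A assume A: "A \<in> admissible_cdfs (s / \<sigma> p)"
        have Ab: "1 - A b \<le> \<eta> p"
        proof (cases "s \<le> 0")
          case True
          then have "s / \<sigma> p \<le> b" unfolding b_def using elim \<epsilon> by (intro divide_right_mono) auto
          then have "A (s / \<sigma> p) \<le> A b" using A by (auto simp: admissible_cdfs_def dest: monoD)
          then show ?thesis using A True by (auto simp: admissible_cdfs_def \<eta>_def)
        next
          case False
          then have "b = \<epsilon> / \<sigma> p" by (simp add: b_def)
          then show ?thesis using A False by (auto simp: admissible_cdfs_def \<eta>_def)
        qed
        \<comment> \<open>The weight \<open>sqrt (f p)\<close> balances the two terms on the left;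
          the weight \<open>1 / \<epsilon>\<close> on the right trades the vanishing
          \<open>\<eta> p\<close> for an error of \<open>\<epsilon> / 2\<close>.\<close>
        have "density_fidelity (deriv A) (normal_density (m / \<sigma> p) (\<tau> p / \<sigma> p))
          \<le> (sqrt (f p) + std_normal_cdf ((b - m / \<sigma> p) / (\<tau> p / \<sigma> p)) / sqrt (f p)) / 2
            + ((1 / \<epsilon>) * (1 - A b) + 1 / (1 / \<epsilon>)) / 2"
          using elim \<epsilon> f0 by (intro density_fidelity_admissible_le[OF A]) auto
        also have "std_normal_cdf ((b - m / \<sigma> p) / (\<tau> p / \<sigma> p)) = f p"
          unfolding eq f_def ..
        also have "(sqrt (f p) + f p / sqrt (f p)) / 2 + ((1 / \<epsilon>) * (1 - A b) + 1 / (1 / \<epsilon>)) / 2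
          \<le> (sqrt (f p) + f p / sqrt (f p)) / 2 + ((1 / \<epsilon>) * \<eta> p + 1 / (1 / \<epsilon>)) / 2"
          using Ab \<epsilon> by (intro add_mono divide_right_mono mult_left_mono order_refl) auto
        also have "\<dots> = sqrt (f p) + (\<eta> p / \<epsilon> + \<epsilon>) / 2"
          using f0 by (simp add: real_div_sqrt)
        finally show "density_fidelity (deriv A) (normal_density (m / \<sigma> p) (sqrt ((\<tau> p / \<sigma> p)\<^sup>2)))
          \<le> sqrt (f p) + (\<eta> p / \<epsilon> + \<epsilon>) / 2"
          using elim by simp
      qed (use elim in auto)
    qed
    ultimately show ?thesis by auto
  qed
  let ?L = "std_normal_cdf ((min s 0 - m) / c)"
  have "(S \<longlongrightarrow> ?L) F"
  proof (rule order_tendstoI)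
    fix x assume x: "x < ?L"
    have "((\<lambda>\<epsilon>. std_normal_cdf ((min s 0 - \<epsilon> - m) / c) * (1 + 2 * \<epsilon>) / (1 + \<epsilon>)\<^sup>2)
      \<longlongrightarrow> std_normal_cdf ((min s 0 - 0 - m) / c) * (1 + 2 * 0) / (1 + 0)\<^sup>2) (at_right 0)"
      using c by (intro tendsto_cdf tendsto_intros) auto
    then have "\<forall>\<^sub>F \<epsilon> in at_right 0. x < std_normal_cdf ((min s 0 - \<epsilon> - m) / c) * (1 + 2 * \<epsilon>) / (1 + \<epsilon>)\<^sup>2"
      by (rule order_tendstoD(1)) (use x in simp)
    then have "\<forall>\<^sub>F \<epsilon> in at_right 0. 0 < \<epsilon> \<and> x < std_normal_cdf ((min s 0 - \<epsilon> - m) / c) * (1 + 2 * \<epsilon>) / (1 + \<epsilon>)\<^sup>2"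
      using eventually_at_right_less[of "0 :: real"] by eventually_elim simp
    then obtain \<epsilon> where \<epsilon>: "0 < \<epsilon>" "x < std_normal_cdf ((min s 0 - \<epsilon> - m) / c) * (1 + 2 * \<epsilon>) / (1 + \<epsilon>)\<^sup>2"
      using eventually_happens'[OF trivial_limit_at_right_real] by blast
    have "((\<lambda>p. std_normal_cdf ((min s 0 - \<epsilon> - m) / \<tau> p) * (1 + 2 * \<epsilon>) / (1 + \<epsilon>)\<^sup>2)
      \<longlongrightarrow> std_normal_cdf ((min s 0 - \<epsilon> - m) / c) * (1 + 2 * \<epsilon>) / (1 + \<epsilon>)\<^sup>2) F"
      using c \<epsilon> by (intro tendsto_cdf tendsto_intros \<tau>) auto
    from order_tendstoD(1)[OF this \<epsilon>(2)] lower[OF \<epsilon>(1)]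
    show "\<forall>\<^sub>F p in F. x < S p" by eventually_elim auto
  next
    fix x assume x: "?L < x"
    have "((\<lambda>\<epsilon>. (sqrt (std_normal_cdf ((min s 0 + \<epsilon> - m) / c)) + \<epsilon> / 2)\<^sup>2)
      \<longlongrightarrow> (sqrt (std_normal_cdf ((min s 0 + 0 - m) / c)) + 0 / 2)\<^sup>2) (at_right 0)"
      using c by (intro tendsto_cdf tendsto_intros) auto
    then have "\<forall>\<^sub>F \<epsilon> in at_right 0. (sqrt (std_normal_cdf ((min s 0 + \<epsilon> - m) / c)) + \<epsilon> / 2)\<^sup>2 < x"
      by (rule order_tendstoD(2)) (use x std_normal.cdf_nonneg in simp)
    then have "\<forall>\<^sub>F \<epsilon> in at_right 0. 0 < \<epsilon> \<and> (sqrt (std_normal_cdf ((min s 0 + \<epsilon> - m) / c)) + \<epsilon> / 2)\<^sup>2 < x"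
      using eventually_at_right_less[of "0 :: real"] by eventually_elim simp
    then obtain \<epsilon> where \<epsilon>: "0 < \<epsilon>" "(sqrt (std_normal_cdf ((min s 0 + \<epsilon> - m) / c)) + \<epsilon> / 2)\<^sup>2 < x"
      using eventually_happens'[OF trivial_limit_at_right_real] by blast
    obtain B where B: "(B \<longlongrightarrow> (sqrt (std_normal_cdf ((min s 0 + \<epsilon> - m) / c)) + \<epsilon> / 2)\<^sup>2) F" "\<forall>\<^sub>F p in F. S p \<le> B p"
      using upper[OF \<epsilon>(1)] by blast
    from order_tendstoD(2)[OF B(1) \<epsilon>(2)] B(2)
    show "\<forall>\<^sub>F p in F. S p < x" by eventually_elim auto
  qed
  then show ?thesis by (simp add: S_def[abs_def])
qed

section \<open>Second-order asymptotics\<close>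

lemma pmf_replicate_pmf:
  "pmf (replicate_pmf n Q) ys = (if length ys = n then \<Prod>y\<leftarrow>ys. pmf Q y else 0)"
proof (induction n arbitrary: ys)
  case 0
  then show ?case by (simp add: indicator_def)
next
  case (Suc n)
  show ?case
  proof (cases ys)
    case Nil
    then have "ys \<notin> set_pmf (replicate_pmf (Suc n) Q)" by (auto simp: set_replicate_pmf)
    then show ?thesis using Nil by (simp add: set_pmf_iff del: replicate_pmf.simps)
  next
    case (Cons z zs)
    have "pmf (replicate_pmf (Suc n) Q) ys = pmf (pair_pmf Q (replicate_pmf n Q)) (z, zs)"
      unfolding replicate_pmf_Suc_conv_pair Cons using pmf_map_inj'[of "\<lambda>(y, ys). y # ys" _ "(z, zs)"] by (simp add: inj_def split_beta prod_eq_iff)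
    then show ?thesis using Suc Cons by (simp add: pmf_pair)
  qed
qed

lemma finite_words: "finite X \<Longrightarrow> finite (words X n)"
  unfolding words_def using finite_lists_length_eq by blast

lemma card_words: "finite X \<Longrightarrow> card (words X n) = card X ^ n"
  unfolding words_def by (rule card_lists_length_eq)

lemma words_nonempty: "X \<noteq> {} \<Longrightarrow> words X n \<noteq> {}"
proof -
  assume "X \<noteq> {}"
  then obtain x where "x \<in> X" by auto
  then have "replicate n x \<in> words X n" by (auto simp: words_def)
  then show ?thesis by auto
qed

text \<open>Makes \<open>fidelity_D_ge\<close>, which assumes a uniform source, applicable to the
  product source.\<close>

lemma replicate_pmf_of_set:
  assumes "finite X" "X \<noteq> {}"
  shows "replicate_pmf n (pmf_of_set X) = pmf_of_set (words X n)"
proof (rule pmf_eqI)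
  fix xs
  have W: "finite (words X n)" "words X n \<noteq> {}" using finite_words[OF assms(1)] words_nonempty[OF assms(2)] by auto
  have "(\<Prod>x\<leftarrow>xs. pmf (pmf_of_set X) x) = indicator {xs. set xs \<subseteq> X} xs / real (card X) ^ length xs" for xs
    using assms by (induction xs) (auto simp: indicator_def)
  then have "pmf (replicate_pmf n (pmf_of_set X)) xs
    = (if length xs = n then indicator {xs. set xs \<subseteq> X} xs / real (card X) ^ n else 0)"
    by (simp add: pmf_replicate_pmf)
  moreover have "pmf (pmf_of_set (words X n)) xs = indicator (words X n) xs / real (card X) ^ n"
    using W assms by (simp add: card_words)
  ultimately show "pmf (replicate_pmf n (pmf_of_set X)) xs = pmf (pmf_of_set (words X n)) xs"
    by (simp add: words_def indicator_def)
qed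

text \<open>All summands of the entropy are nonnegative, so entropy 0 would make every logarithm on
  the support vanish, and the varentropy with it.\<close>

lemma entropy_pos:
  assumes fin: "finite (set_pmf Q)" and v: "varentropy Q > 0"
  shows "shannon_entropy Q > 0"
proof -
  have nn: "pmf Q y * - log 2 (pmf Q y) \<ge> 0" for y
    using pmf_le_1[of Q y] pmf_nonneg[of Q y]
    by (cases "pmf Q y = 0") (auto simp: mult_nonneg_nonpos)
  have eq: "shannon_entropy Q = (\<Sum>y\<in>set_pmf Q. pmf Q y * - log 2 (pmf Q y))"
    by (simp add: shannon_entropy_def sum_negf)
  have "shannon_entropy Q \<noteq> 0"
  proof
    assume 0: "shannon_entropy Q = 0"
    then have "\<forall>y\<in>set_pmf Q. pmf Q y * - log 2 (pmf Q y) = 0"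
      unfolding eq using fin nn by (subst (asm) sum_nonneg_eq_0_iff) auto
    then have "log 2 (pmf Q y) = 0" if "y \<in> set_pmf Q" for y
      using that by (auto simp: set_pmf_iff)
    then have "varentropy Q = 0" by (simp add: varentropy_def 0)
    then show False using v by simp
  qed
  moreover have "shannon_entropy Q \<ge> 0" unfolding eq using nn by (intro sum_nonneg) auto
  ultimately show ?thesis by linarith
qed

text \<open>On the support, minus the logarithm of the mass of a word is the sum of the
  self-informations of its letters, so a threshold on the mass is one on a normalized sum. Off the
  support the events may differ, hence the comparison almost everywhere.\<close>

lemma prob_pmf_ge_eq:
  assumes \<theta>: "\<theta> > 0" and v: "v > 0" and n: "n > 0"
  shows "measure_pmf.prob (replicate_pmf n Q) {ys. \<theta> \<le> pmf (replicate_pmf n Q) ys}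
    = measure_pmf.prob (replicate_pmf n Q)
        {ys. (\<Sum>y\<leftarrow>ys. - log 2 (pmf Q y) - h) / sqrt (real n * v) \<le> (- log 2 \<theta> - real n * h) / sqrt (real n * v)}"
proof (rule measure_pmf.finite_measure_eq_AE)
  show "AE ys in replicate_pmf n Q. (ys \<in> {ys. \<theta> \<le> pmf (replicate_pmf n Q) ys}) =
    (ys \<in> {ys. (\<Sum>y\<leftarrow>ys. - log 2 (pmf Q y) - h) / sqrt (real n * v) \<le> (- log 2 \<theta> - real n * h) / sqrt (real n * v)})"
    unfolding AE_measure_pmf_iff
  proof
    fix ys assume "ys \<in> set_pmf (replicate_pmf n Q)"
    then have ys: "set ys \<subseteq> set_pmf Q" "length ys = n" by (auto simp: set_replicate_pmf)
    \<comment> \<open>Stated for words of any length so that induction on the word applies.\<close>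
    have pos: "0 < (\<Prod>y\<leftarrow>ys. pmf Q y)" and
      lg: "(\<Sum>y\<leftarrow>ys. - log 2 (pmf Q y) - h) = - log 2 (\<Prod>y\<leftarrow>ys. pmf Q y) - length ys * h"
      if "set ys \<subseteq> set_pmf Q" for ys
      using that by (induction ys) (auto simp: pmf_positive set_pmf_iff log_mult algebra_simps)
    have c: "sqrt (real n * v) > 0" using v n by simp
    have "\<theta> \<le> pmf (replicate_pmf n Q) ys \<longleftrightarrow> log 2 \<theta> \<le> log 2 (\<Prod>y\<leftarrow>ys. pmf Q y)"
      using \<theta> pos[OF ys(1)] ys(2) by (simp add: pmf_replicate_pmf)
    also have "\<dots> \<longleftrightarrow> (\<Sum>y\<leftarrow>ys. - log 2 (pmf Q y) - h) / sqrt (real n * v) \<le> (- log 2 \<theta> - real n * h) / sqrt (real n * v)"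
      unfolding divide_le_cancel lg[OF ys(1)] ys(2) using c by auto
    finally show "(ys \<in> {ys. \<theta> \<le> pmf (replicate_pmf n Q) ys}) =
      (ys \<in> {ys. (\<Sum>y\<leftarrow>ys. - log 2 (pmf Q y) - h) / sqrt (real n * v) \<le> (- log 2 \<theta> - real n * h) / sqrt (real n * v)})"
      by simp
  qed
qed auto

text \<open>By monotonicity the moving argument can be replaced by a fixed point on either side of
  \<open>x\<close>, where pointwise convergence applies; continuity of \<open>G\<close> controls the
  error.\<close>

lemma tendsto_mono_family:
  fixes F :: "nat \<Rightarrow> real \<Rightarrow> real"
  assumes mono: "\<And>k. mono (F k)" and lim: "\<And>x. (\<lambda>k. F k x) \<longlonglongrightarrow> G x" and cont: "isCont G x"
    and m: "filterlim m sequentially S" and f: "(f \<longlongrightarrow> x) S"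
  shows "((\<lambda>n. F (m n) (f n)) \<longlongrightarrow> G x) S"
proof (rule order_tendstoI)
  have lim': "((\<lambda>n. F (m n) y) \<longlongrightarrow> G y) S" for y
    using filterlim_compose[OF lim m] .
  {
    fix a assume "a < G x"
    then obtain d where d: "d > 0" "\<And>y. \<bar>y - x\<bar> < d \<Longrightarrow> a < G y"
      using order_tendstoD(1)[OF cont[unfolded continuous_at]] unfolding eventually_at_filter
      by (force simp: eventually_nhds_metric dist_real_def)
    have "a < G (x - d / 2)" "x - d / 2 < x" using d by auto
    from order_tendstoD(1)[OF lim' this(1)] order_tendstoD(1)[OF f this(2)]
    show "\<forall>\<^sub>F n in S. a < F (m n) (f n)"
      by eventually_elim (meson less_imp_le less_le_trans mono monoD)
  next
    fix a assume "G x < a"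
    then obtain d where d: "d > 0" "\<And>y. \<bar>y - x\<bar> < d \<Longrightarrow> G y < a"
      using order_tendstoD(2)[OF cont[unfolded continuous_at]] unfolding eventually_at_filter
      by (force simp: eventually_nhds_metric dist_real_def)
    have "G (x + d / 2) < a" "x < x + d / 2" using d by auto
    from order_tendstoD(2)[OF lim' this(1)] order_tendstoD(2)[OF f this(2)]
    show "\<forall>\<^sub>F n in S. F (m n) (f n) < a"
      by eventually_elim (meson less_imp_le le_less_trans mono monoD)
  }
qed

text \<open>Central limit theorem for self-informations with length and threshold both moving;
  monotone distribution functions and a continuous limit permit this.\<close>

lemma prob_pmf_ge_tendsto:
  assumes fin: "finite (set_pmf Q)" and v: "varentropy Q > 0"
    and m: "filterlim m sequentially sequentially"
    and \<theta>: "\<forall>\<^sub>F n in sequentially. \<theta> n > 0"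
    and lim: "(\<lambda>n. (- log 2 (\<theta> n) - m n * shannon_entropy Q) / sqrt (m n * varentropy Q)) \<longlonglongrightarrow> x"
  shows "(\<lambda>n. measure_pmf.prob (replicate_pmf (m n) Q) {ys. \<theta> n \<le> pmf (replicate_pmf (m n) Q) ys})
    \<longlonglongrightarrow> std_normal_cdf x"
proof -
  let ?h = "shannon_entropy Q" and ?v = "varentropy Q"
  let ?g = "\<lambda>y. - log 2 (pmf Q y)"
  define F where "F n x = measure_pmf.prob (replicate_pmf n Q)
    {ys. (\<Sum>y\<leftarrow>ys. ?g y - ?h) / sqrt (real n * ?v) \<le> x}" for n x
  have mean: "measure_pmf.expectation Q ?g = ?h"
    by (subst integral_measure_pmf[OF fin]) (auto simp: shannon_entropy_def sum_negf)
  have var: "measure_pmf.variance Q ?g = ?v"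
    unfolding mean by (subst integral_measure_pmf[OF fin]) (auto simp: varentropy_def)
  have lim1: "(\<lambda>n. F (m n) ((- log 2 (\<theta> n) - m n * ?h) / sqrt (m n * ?v))) \<longlonglongrightarrow> std_normal_cdf x"
  proof (rule tendsto_mono_family[OF _ _ isCont_std_normal_cdf m lim])
    show "mono (F k)" for k
      unfolding F_def by (intro monoI measure_pmf.finite_measure_mono) auto
    show "(\<lambda>k. F k y) \<longlonglongrightarrow> std_normal_cdf y" for y
      unfolding F_def by (rule central_limit_theorem_replicate_pmf[OF fin mean var v])
  qed
  have "\<forall>\<^sub>F n in sequentially. m n > 0"
    by (rule eventually_compose_filterlim[OF eventually_gt_at_top m])
  with \<theta> have "\<forall>\<^sub>F n in sequentially. F (m n) ((- log 2 (\<theta> n) - m n * ?h) / sqrt (m n * ?v))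
    = measure_pmf.prob (replicate_pmf (m n) Q) {ys. \<theta> n \<le> pmf (replicate_pmf (m n) Q) ys}"
    by eventually_elim (simp add: F_def prob_pmf_ge_eq[OF _ v, where h = "shannon_entropy Q"])
  then show ?thesis using lim1 by (rule Lim_transform_eventually[rotated])
qed

section \<open>Asymptotics of storage size and target length\<close>

lemma bounded_div_sqrt_tendsto_0:
  fixes e :: "nat \<Rightarrow> real"
  assumes "\<forall>\<^sub>F n in sequentially. \<bar>e n\<bar> \<le> c"
  shows "(\<lambda>n. e n / sqrt (real n)) \<longlonglongrightarrow> 0"
proof (rule Lim_null_comparison)
  show "\<forall>\<^sub>F n in sequentially. norm (e n / sqrt (real n)) \<le> c / sqrt (real n)"
    using assms by eventually_elim (simp add: divide_right_mono)
  show "(\<lambda>n. c / sqrt (real n)) \<longlonglongrightarrow> 0" by real_asymp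
qed

lemma linear_plus_sqrt_at_top:
  fixes L s :: real
  assumes "L > 0"
  shows "filterlim (\<lambda>n :: nat. L * real n + s * sqrt (real n)) at_top sequentially"
  using assms by real_asymp

text \<open>For nonnegative \<open>s\<close> the number of words is the bottleneck and the formula
  is exact; for negative \<open>s\<close> the storage is, and rounding its size down costs at most
  one bit.\<close>

lemma log_storage_size_bounds:
  fixes l :: nat and s :: real
  assumes l: "l \<ge> 2"
  defines "M n \<equiv> min (l ^ n) (nat \<lfloor>2 powr (log 2 l * n + s * sqrt n)\<rfloor>)"
  shows "\<forall>\<^sub>F n in sequentially. M n > 0 \<and> \<bar>log 2 (M n) - (log 2 l * n + min s 0 * sqrt n)\<bar> \<le> 1"
proof -
  define N where "N n = log 2 l * real n + s * sqrt (real n)" for n :: nat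
  have L: "log 2 l > 0" using l by simp
  have pw: "real (l ^ n) = 2 powr (log 2 l * n)" for n
  proof -
    have "2 powr (log 2 l * n) = (2 powr log 2 l) powr n" by (simp add: powr_powr)
    also have "\<dots> = real l ^ n" using l by (simp add: powr_realpow)
    finally show ?thesis by simp
  qed
  have "filterlim N at_top sequentially" unfolding N_def by (rule linear_plus_sqrt_at_top[OF L])
  then have "\<forall>\<^sub>F n in sequentially. N n \<ge> 0" by (simp add: filterlim_at_top)
  then show ?thesis
  proof eventually_elim
    case (elim n)
    show ?case
    proof (cases "s \<ge> 0")
      case True
      then have "real (l ^ n) \<le> 2 powr N n" unfolding pw N_def by (intro powr_mono) auto
      then have "l ^ n \<le> nat \<lfloor>2 powr N n\<rfloor>" by (simp add: le_nat_floor)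
      then have "M n = l ^ n" by (simp add: M_def N_def)
      moreover from this have "log 2 (M n) = log 2 l * n"
        using l by (simp add: log_nat_power mult.commute)
      ultimately show ?thesis using True l by simp
    next
      case False
      let ?x = "2 powr N n"
      have x1: "?x \<ge> 1" using elim by (simp add: ge_one_powr_ge_zero)
      have "?x \<le> real (l ^ n)" unfolding pw N_def using False by (intro powr_mono) (auto simp: mult_nonpos_nonneg)
      then have "nat \<lfloor>?x\<rfloor> \<le> l ^ n" by linarith
      then have M: "M n = nat \<lfloor>?x\<rfloor>" by (simp add: M_def N_def)
      \<comment> \<open>The floor of a number that is at least 1 is at least half of it.\<close>
      have "real_of_int \<lfloor>?x\<rfloor> \<ge> 1" using x1 by simp
      then have "real (M n) \<le> ?x" "real (M n) \<ge> ?x / 2"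
        unfolding M using real_of_int_floor_add_one_gt[of ?x] by linarith+
      moreover have M0: "M n > 0" unfolding M using x1 by linarith
      ultimately have "log 2 (M n) \<le> log 2 ?x" "log 2 (?x / 2) \<le> log 2 (M n)"
        by (intro log_mono; simp)+
      then have "log 2 (M n) \<le> N n" "N n - 1 \<le> log 2 (M n)" by (simp_all add: log_divide)
      then show ?thesis using M0 False by (simp add: N_def)
    qed
  qed
qed

lemma target_length_asymp:
  fixes L h t :: real
  assumes "L > 0" "h > 0"
  defines "m n \<equiv> nat \<lfloor>L / h * real n + t * sqrt (real n)\<rfloor>"
  shows "\<forall>\<^sub>F n in sequentially. \<bar>real (m n) - (L / h * n + t * sqrt n)\<bar> \<le> 1"
    and "filterlim m sequentially sequentially"
    and "(\<lambda>n. real (m n) / n) \<longlonglongrightarrow> L / h"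
proof -
  define a where "a n = L / h * real n + t * sqrt (real n)" for n :: nat
  have lim: "filterlim a at_top sequentially"
    unfolding a_def by (rule linear_plus_sqrt_at_top[OF divide_pos_pos[OF assms(1,2)]])
  then have "\<forall>\<^sub>F n in sequentially. a n \<ge> 0" by (simp add: filterlim_at_top)
  then have ev: "\<forall>\<^sub>F n in sequentially. \<bar>real (m n) - a n\<bar> \<le> 1"
    unfolding m_def a_def[symmetric] by eventually_elim linarith
  then show "\<forall>\<^sub>F n in sequentially. \<bar>real (m n) - (L / h * n + t * sqrt n)\<bar> \<le> 1"
    by (simp add: a_def)
  have "filterlim (\<lambda>n. \<lfloor>a n\<rfloor>) at_top sequentially"
    by (rule filterlim_compose[OF filterlim_floor_sequentially lim])
  then show "filterlim m sequentially sequentially"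
    unfolding m_def a_def[symmetric] by (rule filterlim_compose[OF filterlim_nat_sequentially])
  have "(\<lambda>n. (real (m n) - a n) / sqrt n * (1 / sqrt n) + (L / h + t / sqrt n)) \<longlonglongrightarrow> 0 * 0 + (L / h + 0)"
    by (intro tendsto_intros bounded_div_sqrt_tendsto_0[OF ev]) real_asymp+
  moreover have "\<forall>\<^sub>F n in sequentially. (real (m n) - a n) / sqrt n * (1 / sqrt n) + (L / h + t / sqrt n) = real (m n) / n"
    using eventually_gt_at_top[of 0]
  proof eventually_elim
    case (elim n)
    have "t * sqrt n / n = t / sqrt n"
      using elim real_div_sqrt[of "real n"] by (simp add: field_simps)
    then have "a n / n = L / h + t / sqrt n" using elim by (simp add: a_def add_divide_distrib)
    moreover have "(real (m n) - a n) / sqrt n * (1 / sqrt n) = m n / n - a n / n"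
      by (simp add: diff_divide_distrib)
    ultimately show ?case by simp
  qed
  ultimately show "(\<lambda>n. real (m n) / n) \<longlonglongrightarrow> L / h"
    by (simp add: Lim_transform_eventually)
qed

text \<open>In the numerator the terms linear in \<open>n\<close> cancel, leaving
  \<open>(min s 0 - h * t) * sqrt n\<close> up to a bounded error that absorbs
  \<open>log 2 \<gamma>\<close>. The radicand of the denominator grows like
  \<open>n * v * log 2 l / h\<close>.\<close>

lemma normalized_threshold_tendsto:
  fixes l :: nat and h v s t \<gamma> :: real
  assumes l: "l \<ge> 2" and h: "h > 0" and v: "v > 0" and \<gamma>: "\<gamma> > 0"
  defines "M n \<equiv> min (l ^ n) (nat \<lfloor>2 powr (log 2 l * n + s * sqrt n)\<rfloor>)"
    and "m n \<equiv> nat \<lfloor>log 2 l / h * real n + t * sqrt (real n)\<rfloor>"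
  shows "(\<lambda>n. (- log 2 (\<gamma> / M n) - m n * h) / sqrt (m n * v))
    \<longlonglongrightarrow> sqrt (h / (v * log 2 l)) * (min s 0 - h * t)"
proof -
  let ?L = "log 2 l"
  have L: "?L > 0" using l by simp
  \<comment> \<open>Rounding errors of the logarithmic size and of the target length, each at most 1
    in absolute value for large \<open>n\<close>.\<close>
  define e1 where "e1 n = log 2 (M n) - (?L * n + min s 0 * sqrt n)" for n
  define e2 where "e2 n = real (m n) - (?L / h * n + t * sqrt n)" for n
  have M: "\<forall>\<^sub>F n in sequentially. M n > 0 \<and> \<bar>e1 n\<bar> \<le> 1"
    unfolding e1_def M_def by (rule log_storage_size_bounds[OF l])
  have e1: "\<forall>\<^sub>F n in sequentially. \<bar>e1 n\<bar> \<le> 1" using M by eventually_elim simp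
  have e2: "\<forall>\<^sub>F n in sequentially. \<bar>e2 n\<bar> \<le> 1"
    unfolding e2_def m_def by (rule target_length_asymp(1)[OF L h])
  have mn: "(\<lambda>n. real (m n) / n) \<longlonglongrightarrow> ?L / h"
    unfolding m_def by (rule target_length_asymp(3)[OF L h])
  have "(\<lambda>n. (min s 0 - h * t + e1 n / sqrt n - h * (e2 n / sqrt n) - log 2 \<gamma> / sqrt n) / sqrt (real (m n) / n * v))
    \<longlonglongrightarrow> (min s 0 - h * t + 0 - h * 0 - 0) / sqrt (?L / h * v)"
  proof (intro mn bounded_div_sqrt_tendsto_0 tendsto_intros)
    show "\<forall>\<^sub>F n in sequentially. \<bar>log 2 \<gamma>\<bar> \<le> \<bar>log 2 \<gamma>\<bar>" by simp
    show "sqrt (?L / h * v) \<noteq> 0" using L h v by simp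
  qed (use e1 e2 in auto)
  moreover have "\<forall>\<^sub>F n in sequentially.
      (min s 0 - h * t + e1 n / sqrt n - h * (e2 n / sqrt n) - log 2 \<gamma> / sqrt n) / sqrt (real (m n) / n * v)
      = (- log 2 (\<gamma> / M n) - m n * h) / sqrt (m n * v)"
    using M eventually_gt_at_top[of 0]
  proof eventually_elim
    case (elim n)
    define r where "r = sqrt (real n)"
    have r: "r > 0" using elim by (simp add: r_def)
    have "- log 2 (\<gamma> / M n) - m n * h = log 2 (M n) - log 2 \<gamma> - m n * h"
      using elim \<gamma> by (simp add: log_divide)
    also have "\<dots> = (min s 0 - h * t) * r + e1 n - h * e2 n - log 2 \<gamma>"
      using h by (simp add: e1_def e2_def r_def field_simps)
    also have "\<dots> = (min s 0 - h * t + e1 n / r - h * (e2 n / r) - log 2 \<gamma> / r) * r"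
      using r by (simp add: field_simps)
    finally have num: "(min s 0 - h * t + e1 n / r - h * (e2 n / r) - log 2 \<gamma> / r) * r = - log 2 (\<gamma> / M n) - m n * h" ..
    have den: "sqrt (real (m n) / n * v) * r = sqrt (m n * v)"
      using elim by (simp add: r_def real_sqrt_mult real_sqrt_divide)
    show ?case
      unfolding num[symmetric] den[symmetric] r_def[symmetric] using r by simp
  qed
  ultimately have "(\<lambda>n. (- log 2 (\<gamma> / M n) - m n * h) / sqrt (m n * v))
    \<longlonglongrightarrow> (min s 0 - h * t + 0 - h * 0 - 0) / sqrt (?L / h * v)"
    by (rule Lim_transform_eventually)
  moreover have "(min s 0 - h * t + 0 - h * 0 - 0) / sqrt (?L / h * v) = sqrt (h / (v * ?L)) * (min s 0 - h * t)"
    using L h v by (simp add: real_sqrt_divide real_sqrt_mult ac_simps)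
  ultimately show ?thesis by simp
qed

text \<open>First \<open>n\<close> tends to infinity with \<gamma> fixed, then \<gamma> tends to
  infinity in the lower bound and to 0 in the upper one. This works because \<open>w\<close> is the
  same for every \<gamma>.\<close>

lemma squeeze_fidelity_limit:
  fixes f :: "nat \<Rightarrow> real" and p :: "real \<Rightarrow> nat \<Rightarrow> real"
  assumes p: "\<And>\<gamma>. \<gamma> > 0 \<Longrightarrow> p \<gamma> \<longlonglongrightarrow> w"
    and low: "\<And>\<gamma>. \<gamma> \<ge> 1 \<Longrightarrow> \<forall>\<^sub>F n in sequentially. sqrt ((1 - 1 / \<gamma>) * p \<gamma> n) \<le> f n"
    and up: "\<And>\<gamma>. \<gamma> > 0 \<Longrightarrow> \<forall>\<^sub>F n in sequentially. f n \<le> sqrt (p \<gamma> n + \<gamma>)"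
  shows "f \<longlonglongrightarrow> sqrt w"
proof (rule order_tendstoI)
  fix a assume a: "a < sqrt w"
  have "((\<lambda>\<gamma>. sqrt ((1 - 1 / \<gamma>) * w)) \<longlongrightarrow> sqrt ((1 - 0) * w)) at_top"
    by (intro tendsto_intros) real_asymp
  then have "\<forall>\<^sub>F \<gamma> in at_top. a < sqrt ((1 - 1 / \<gamma>) * w)"
    by (rule order_tendstoD(1)) (use a in simp)
  then have "\<forall>\<^sub>F \<gamma> in at_top. \<gamma> \<ge> 1 \<and> a < sqrt ((1 - 1 / \<gamma>) * w)"
    using eventually_ge_at_top[of "1 :: real"] by eventually_elim simp
  then obtain \<gamma> where \<gamma>: "\<gamma> \<ge> 1" "a < sqrt ((1 - 1 / \<gamma>) * w)"
    using eventually_happens'[OF trivial_limit_at_top_linorder] by blast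
  have "(\<lambda>n. sqrt ((1 - 1 / \<gamma>) * p \<gamma> n)) \<longlonglongrightarrow> sqrt ((1 - 1 / \<gamma>) * w)"
    using \<gamma> by (intro tendsto_intros p) simp
  from order_tendstoD(1)[OF this \<gamma>(2)] low[OF \<gamma>(1)]
  show "\<forall>\<^sub>F n in sequentially. a < f n" by eventually_elim simp
next
  fix a assume a: "sqrt w < a"
  have "((\<lambda>\<gamma>. sqrt (w + \<gamma>)) \<longlongrightarrow> sqrt (w + 0)) (at_right 0)" by (intro tendsto_intros)
  then have "\<forall>\<^sub>F \<gamma> in at_right 0. sqrt (w + \<gamma>) < a"
    by (rule order_tendstoD(2)) (use a in simp)
  then have "\<forall>\<^sub>F \<gamma> in at_right 0. \<gamma> > 0 \<and> sqrt (w + \<gamma>) < a"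
    using eventually_at_right_less[of "0 :: real"] by eventually_elim simp
  then obtain \<gamma> where \<gamma>: "\<gamma> > 0" "sqrt (w + \<gamma>) < a"
    using eventually_happens'[OF trivial_limit_at_right_real] by blast
  have "(\<lambda>n. sqrt (p \<gamma> n + \<gamma>)) \<longlonglongrightarrow> sqrt (w + \<gamma>)"
    using \<gamma> by (intro tendsto_intros p)
  from order_tendstoD(2)[OF this \<gamma>(2)] up[OF \<gamma>(1)]
  show "\<forall>\<^sub>F n in sequentially. f n < a" by eventually_elim simp
qed

section \<open>Entropy and varentropy near the uniform distribution\<close>

lemma shannon_entropy_pmf_of_set:
  assumes "finite X" "X \<noteq> {}"
  shows "shannon_entropy (pmf_of_set X) = log 2 (card X)"
  using assms by (simp add: shannon_entropy_def log_divide card_gt_0_iff)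

text \<open>Rewritten over the fixed set \<open>X\<close>, the sums depend continuously on the
  masses, which tend to \<open>1 / card X\<close>, a point of continuity of the logarithm.
  Nonuniformity keeps the varentropy strictly above its limit 0.\<close>

lemma nonuniform_nhds_limits:
  assumes X: "finite X" "X \<noteq> {}"
  shows "(shannon_entropy \<longlongrightarrow> log 2 (card X)) (nonuniform_nhds X (pmf_of_set X))"
    and "filterlim varentropy (at_right 0) (nonuniform_nhds X (pmf_of_set X))"
proof -
  let ?F = "nonuniform_nhds X (pmf_of_set X)" and ?k = "real (card X)"
  have k: "?k > 0" using X by (simp add: card_gt_0_iff)
  have "filterlim (\<lambda>P. P) ?F ?F" by (rule filterlim_ident)
  then have pt: "((\<lambda>P. pmf P x) \<longlongrightarrow> pmf (pmf_of_set X) x) ?F" for x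
    unfolding tendsto_nonuniform_nhds_iff by auto
  from \<open>filterlim (\<lambda>P. P) ?F ?F\<close> have ev: "\<forall>\<^sub>F P in ?F. P \<in> distributions_on X \<and> nonuniform P"
    unfolding tendsto_nonuniform_nhds_iff by auto
  have pt': "((\<lambda>P. pmf P x) \<longlongrightarrow> 1 / ?k) ?F" if "x \<in> X" for x
    using pt[of x] that X by simp
  have sums: "shannon_entropy P = - (\<Sum>x\<in>X. pmf P x * log 2 (pmf P x))"
    "varentropy P = (\<Sum>x\<in>X. pmf P x * (- log 2 (pmf P x) - shannon_entropy P)\<^sup>2)"
    if "P \<in> distributions_on X" for P
    using that X unfolding distributions_on_def
    by (auto simp: shannon_entropy_def varentropy_def set_pmf_iff intro!: sum.mono_neutral_left)
  have "((\<lambda>P. - (\<Sum>x\<in>X. pmf P x * log 2 (pmf P x))) \<longlongrightarrow> - (\<Sum>x\<in>X. 1 / ?k * log 2 (1 / ?k))) ?F"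
    using k by (intro tendsto_intros pt') auto
  moreover have "- (\<Sum>x\<in>X. 1 / ?k * log 2 (1 / ?k)) = log 2 ?k"
    using k by (simp add: log_divide)
  moreover have "\<forall>\<^sub>F P in ?F. - (\<Sum>x\<in>X. pmf P x * log 2 (pmf P x)) = shannon_entropy P"
    using ev by eventually_elim (simp add: sums)
  ultimately show H: "(shannon_entropy \<longlongrightarrow> log 2 ?k) ?F"
    using Lim_transform_eventually by fastforce
  have "((\<lambda>P. \<Sum>x\<in>X. pmf P x * (- log 2 (pmf P x) - shannon_entropy P)\<^sup>2)
    \<longlongrightarrow> (\<Sum>x\<in>X. 1 / ?k * (- log 2 (1 / ?k) - log 2 ?k)\<^sup>2)) ?F"
    using k by (intro tendsto_intros pt' H) auto
  moreover have "(\<Sum>x\<in>X. 1 / ?k * (- log 2 (1 / ?k) - log 2 ?k)\<^sup>2) = 0"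
    using k by (simp add: log_divide)
  moreover have "\<forall>\<^sub>F P in ?F. (\<Sum>x\<in>X. pmf P x * (- log 2 (pmf P x) - shannon_entropy P)\<^sup>2) = varentropy P"
    using ev by eventually_elim (simp add: sums)
  ultimately have V: "(varentropy \<longlongrightarrow> 0) ?F"
    using Lim_transform_eventually by fastforce
  have "\<forall>\<^sub>F P in ?F. varentropy P > 0"
    using ev
  proof eventually_elim
    case (elim P)
    then have "finite (set_pmf P)" using X finite_subset by (auto simp: distributions_on_def)
    then show ?case using elim nonuniform_iff_varentropy_pos by blast
  qed
  with V show "filterlim varentropy (at_right 0) ?F"
    by (auto simp: filterlim_at elim: eventually_mono)
qed

theorem theorem28:
  fixes l :: nat and X :: "'a set" and Y :: "'b set" and Q :: "'b pmf" and s\<^sub>2 t\<^sub>2 :: real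
  assumes "l \<ge> 2" and "finite X" and "card X = l"
    and "finite Y" and "Q \<in> distributions_on Y" and "nonuniform Q"
  shows "asymp_fidelity_D X (pmf_of_set X) Y Q s\<^sub>2 t\<^sub>2 = asymp_fidelity_M (pmf_of_set X) Y Q s\<^sub>2 t\<^sub>2
    \<and> asymp_fidelity_D X (pmf_of_set X) Y Q s\<^sub>2 t\<^sub>2 =
        ereal (sqrt (std_normal_cdf
          (sqrt (shannon_entropy Q / (varentropy Q * log 2 (real l)))
            * (min s\<^sub>2 0 - shannon_entropy Q * t\<^sub>2))))
    \<and> ((\<lambda>P. ereal (sqrt (1 - Z_dist (C_param P Q) (s\<^sub>2 / sqrt (varentropy P)) (t\<^sub>2 * D_param P Q))))
        \<longlongrightarrow> asymp_fidelity_D X (pmf_of_set X) Y Q s\<^sub>2 t\<^sub>2) (nonuniform_nhds X (pmf_of_set X))"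
proof -
  let ?h = "shannon_entropy Q" and ?v = "varentropy Q" and ?U = "pmf_of_set X" and ?L = "log 2 (real l)"
  let ?x = "sqrt (?h / (?v * ?L)) * (min s\<^sub>2 0 - ?h * t\<^sub>2)"
  have X: "finite X" "X \<noteq> {}" using assms(1-3) by auto
  have QY: "set_pmf Q \<subseteq> Y" using assms(5) by (simp add: distributions_on_def)
  then have Y: "finite Y" "Y \<noteq> {}" using assms(4) set_pmf_not_empty[of Q] by auto
  have fin: "finite (set_pmf Q)" using QY Y(1) by (rule finite_subset)
  have v: "?v > 0" using assms(6) nonuniform_iff_varentropy_pos[OF fin] by simp
  have h: "?h > 0" by (rule entropy_pos[OF fin v])
  have L: "?L > 0" using assms(1) by simp
  have HU: "shannon_entropy ?U = ?L" using shannon_entropy_pmf_of_set[OF X] assms(3) by simp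
  define m where "m n = target_length ?U Q t\<^sub>2 n" for n
  define N where "N n = storage_bits ?U s\<^sub>2 n" for n
  define M where "M n = min (l ^ n) (nat \<lfloor>2 powr (?L * n + s\<^sub>2 * sqrt n)\<rfloor>)" for n
  define D where "D n = fidelity_D (words X n) (replicate_pmf n ?U) (words Y (m n)) (replicate_pmf (m n) Q) (N n)" for n
  define E where "E n = fidelity_M (replicate_pmf n ?U) (words Y (m n)) (replicate_pmf (m n) Q) (N n)" for n
  define p where "p \<gamma> n = measure_pmf.prob (replicate_pmf (m n) Q) {ys. \<gamma> / M n \<le> pmf (replicate_pmf (m n) Q) ys}" for \<gamma> n
  \<comment> \<open>The support of the uniform source consists of all words, so the same
    \<open>M n\<close> serves in both one-shot bounds.\<close>
  have M_eq: "M n = min (card (words X n)) (card (storage (N n)))" for n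
    using X assms(3) by (simp add: M_def card_words storage_def N_def storage_bits_def HU)
  have m_eq: "m n = nat \<lfloor>?L / ?h * n + t\<^sub>2 * sqrt n\<rfloor>" for n
    by (simp add: m_def target_length_def HU)
  \<comment> \<open>A storage with a negative number of bits is empty; the one-shot bounds are used
    only where \<open>M n\<close> is positive.\<close>
  have Mpos: "\<forall>\<^sub>F n in sequentially. M n > 0"
    using log_storage_size_bounds[OF assms(1), of s\<^sub>2] unfolding M_def by eventually_elim simp
  have p_lim: "p \<gamma> \<longlonglongrightarrow> std_normal_cdf ?x" if \<gamma>: "\<gamma> > 0" for \<gamma>
    unfolding p_def
  proof (rule prob_pmf_ge_tendsto[OF fin v])
    show "filterlim m sequentially sequentially"
      unfolding m_eq[abs_def] by (rule target_length_asymp(2)[OF L h])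
    show "\<forall>\<^sub>F n in sequentially. \<gamma> / M n > 0"
      using Mpos by eventually_elim (use \<gamma> in simp)
    show "(\<lambda>n. (- log 2 (\<gamma> / M n) - m n * ?h) / sqrt (m n * ?v)) \<longlonglongrightarrow> ?x"
      unfolding m_eq M_def by (rule normalized_threshold_tendsto[OF assms(1) h v \<gamma>])
  qed
  have W: "finite (words X n)" "words X n \<noteq> {}" "finite (words Y k)" "words Y k \<noteq> {}" for n k
    by (rule finite_words words_nonempty X Y)+
  have U: "replicate_pmf n ?U = pmf_of_set (words X n)" for n
    by (rule replicate_pmf_of_set[OF X])
  have supp: "set_pmf (replicate_pmf n ?U) = words X n" for n
    unfolding U using W by simp
  have ne: "storage (N n) \<noteq> {}" if "M n > 0" for n
    using that unfolding M_eq by auto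
  have low: "\<forall>\<^sub>F n in sequentially. sqrt ((1 - 1 / \<gamma>) * p \<gamma> n) \<le> D n" if "\<gamma> \<ge> 1" for \<gamma>
    using Mpos
  proof eventually_elim
    case (elim n)
    have "set_pmf (replicate_pmf (m n) Q) \<subseteq> words Y (m n)"
      using QY by (auto simp: set_replicate_pmf words_def)
    then show ?case
      unfolding p_def D_def U
      by (intro fidelity_D_ge W ne[OF elim] M_eq that)
  qed
  have mid: "\<forall>\<^sub>F n in sequentially. D n \<le> E n"
    using Mpos
  proof eventually_elim
    case (elim n)
    show ?case
      unfolding D_def E_def by (intro fidelity_D_le_fidelity_M W ne[OF elim]) (simp add: supp)
  qed
  have up: "\<forall>\<^sub>F n in sequentially. E n \<le> sqrt (p \<gamma> n + \<gamma>)" if "\<gamma> > 0" for \<gamma>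
    using Mpos
  proof eventually_elim
    case (elim n)
    show ?case
      unfolding p_def E_def
      by (intro fidelity_M_le W ne[OF elim]) (use W that in \<open>simp_all add: supp M_eq\<close>)
  qed
  \<comment> \<open>The lower bound on \<open>D\<close> and the upper bound on \<open>E\<close>
    enclose both sequences, since \<open>D n \<le> E n\<close> eventually.\<close>
  have D_lim: "D \<longlonglongrightarrow> sqrt (std_normal_cdf ?x)"
  proof (rule squeeze_fidelity_limit[OF p_lim low])
    show "\<forall>\<^sub>F n in sequentially. D n \<le> sqrt (p \<gamma> n + \<gamma>)" if "\<gamma> > 0" for \<gamma>
      using mid up[OF that] by eventually_elim simp
  qed auto
  have E_lim: "E \<longlonglongrightarrow> sqrt (std_normal_cdf ?x)"
  proof (rule squeeze_fidelity_limit[OF p_lim _ up])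
    show "\<forall>\<^sub>F n in sequentially. sqrt ((1 - 1 / \<gamma>) * p \<gamma> n) \<le> E n" if "\<gamma> \<ge> 1" for \<gamma>
      using mid low[OF that] by eventually_elim simp
  qed auto
  have D_val: "asymp_fidelity_D X ?U Y Q s\<^sub>2 t\<^sub>2 = ereal (sqrt (std_normal_cdf ?x))"
    unfolding asymp_fidelity_D_def
    using lim_imp_Liminf[OF _ tendsto_ereal[OF D_lim]] by (simp add: D_def m_def N_def)
  have E_val: "asymp_fidelity_M ?U Y Q s\<^sub>2 t\<^sub>2 = ereal (sqrt (std_normal_cdf ?x))"
    unfolding asymp_fidelity_M_def
    using lim_imp_Liminf[OF _ tendsto_ereal[OF E_lim]] by (simp add: E_def m_def N_def)

  \<comment> \<open>Convergence of the \<open>Z\<close>-distances to the common value\<close>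
  let ?F = "nonuniform_nhds X ?U"
  \<comment> \<open>Chosen so that the square of \<open>\<tau> / \<sigma>\<close>, with
    \<open>\<sigma> = sqrt (varentropy P)\<close>, is \<open>C_param P Q\<close>; the mean
    \<open>t\<^sub>2 * D_param P Q\<close> is then \<open>?h * t\<^sub>2 / \<sigma>\<close>, as
    \<open>one_minus_Z_dist_tendsto\<close> expects.\<close>
  let ?\<tau> = "\<lambda>P. sqrt (shannon_entropy P * ?v / ?h)"
  have H_lim: "(shannon_entropy \<longlongrightarrow> ?L) ?F" and V_lim: "filterlim varentropy (at_right 0) ?F"
    using nonuniform_nhds_limits[OF X] assms(3) by simp_all
  have Vpos: "\<forall>\<^sub>F P in ?F. varentropy P > 0" and V0: "(varentropy \<longlongrightarrow> 0) ?F"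
    using V_lim by (auto simp: filterlim_at elim: eventually_mono)
  have "((\<lambda>P. sqrt (varentropy P)) \<longlongrightarrow> 0) ?F"
    using tendsto_real_sqrt[OF V0] by simp
  then have \<sigma>: "filterlim (\<lambda>P. sqrt (varentropy P)) (at_right 0) ?F"
    using Vpos by (auto simp: filterlim_at elim: eventually_mono)
  have \<tau>: "(?\<tau> \<longlongrightarrow> sqrt (?L * ?v / ?h)) ?F"
    using h by (intro tendsto_intros H_lim) simp
  have "((\<lambda>P. 1 - Z_dist ((?\<tau> P / sqrt (varentropy P))\<^sup>2) (s\<^sub>2 / sqrt (varentropy P)) (?h * t\<^sub>2 / sqrt (varentropy P)))
    \<longlongrightarrow> std_normal_cdf ((min s\<^sub>2 0 - ?h * t\<^sub>2) / sqrt (?L * ?v / ?h))) ?F"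
    using L v h by (intro one_minus_Z_dist_tendsto \<sigma> \<tau>) simp
  also have "(min s\<^sub>2 0 - ?h * t\<^sub>2) / sqrt (?L * ?v / ?h) = ?x"
    using L v h by (simp add: real_sqrt_divide real_sqrt_mult ac_simps)
  finally have lim: "((\<lambda>P. 1 - Z_dist ((?\<tau> P / sqrt (varentropy P))\<^sup>2) (s\<^sub>2 / sqrt (varentropy P)) (?h * t\<^sub>2 / sqrt (varentropy P)))
    \<longlongrightarrow> std_normal_cdf ?x) ?F" .
  have "\<forall>\<^sub>F P in ?F. shannon_entropy P > 0" using order_tendstoD(1)[OF H_lim L] .
  with Vpos have "\<forall>\<^sub>F P in ?F.
      1 - Z_dist ((?\<tau> P / sqrt (varentropy P))\<^sup>2) (s\<^sub>2 / sqrt (varentropy P)) (?h * t\<^sub>2 / sqrt (varentropy P))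
      = 1 - Z_dist (C_param P Q) (s\<^sub>2 / sqrt (varentropy P)) (t\<^sub>2 * D_param P Q)"
  proof eventually_elim
    case (elim P)
    have "(?\<tau> P / sqrt (varentropy P))\<^sup>2 = C_param P Q"
      using elim v h by (simp add: power_divide C_param_def field_simps)
    moreover have "?h * t\<^sub>2 / sqrt (varentropy P) = t\<^sub>2 * D_param P Q"
      by (simp add: D_param_def)
    ultimately show ?case by simp
  qed
  with lim have "((\<lambda>P. 1 - Z_dist (C_param P Q) (s\<^sub>2 / sqrt (varentropy P)) (t\<^sub>2 * D_param P Q)) \<longlongrightarrow> std_normal_cdf ?x) ?F"
    by (rule Lim_transform_eventually)
  then show ?thesis
    unfolding D_val E_val by (intro conjI refl tendsto_ereal tendsto_real_sqrt)
qed

end
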